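(* Let $k\ge1$ and $1\le i\le k$ be integers and let $\overline{\mathcal E}_{k,i}(a,q)=\sum_{n,j\ge0}\overline{E}_{k,i}(n,j)\,q^na^j$. Then $$\overline{\mathcal E}_{k,i}(a,q)=\frac{(-aq)_\infty}{(q)_\infty}\sum_{n=-\infty}^{\infty}(-1)^na^nq^{kn^2+(k-i+1)n}\frac{(-1/a)_n}{(-aq)_n}.$$
   Context: $(x)_\infty=(x;q)_\infty=\prod_{m\ge0}(1-xq^m)$ and $(x)_n=(x)_\infty/(xq^n)_\infty$ for every integer $n$ (including negative $n$). $\overline{E}_{k,i}(n,j)$ is the number of lattice paths satisfying the special $(k,i)$-conditions with major index $n$ and $j$ South steps, where: paths lie in the first quadrant, start on the $y$-axis, end on the $x$-axis, and use unit steps North-East $(x,y)\to(x+1,y+1)$, South-East $(x,y)\to(x+1,y-1)$, South $(x,y)\to(x,y-1)$, East $(x,0)\to(x+1,0)$ (East steps only at height $0$); a South step may only occur immediately after a North-East step; a path is either empty or ends with a South-East or South step. The special $(k,i)$-conditions: the path starts at $(0,k-i)$ and every vertex has $y$-coordinate $<k$. A peak is a vertex preceded by a North-East step and followed by a South or South-East step; the major index is the sum of the $x$-coordinates of the peaks. *)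

theory Defs
  imports
    "HOL-Analysis.Analysis"
    "HOL-Computational_Algebra.Formal_Laurent_Series"
    "HOL-Computational_Algebra.Fraction_Field"
begin

text \<open>
  Generating functions live in the field of formal Laurent series in \<open>q\<close> over the field of
  rational functions in \<open>a\<close> with rational coefficients. All infinite sums and products are taken
  in the \<open>q\<close>-adic topology, which is the one given by the library's metric on Laurent series
  (the coefficient field is discrete). Laurent series are needed because \<open>(-1/a)\<^sub>n\<close> and \<open>(-aq)\<^sub>n\<close>
  with negative \<open>n\<close> involve negative powers of \<open>q\<close>.
\<close>

type_synonym series = "rat poly fract fls"

abbreviation var_q :: series where
  "var_q \<equiv> fls_X"

definition var_a :: series where
  "var_a = fls_const (Fract [:0, 1:] 1)"

definition qpoch_inf :: "series \<Rightarrow> series" where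
  "qpoch_inf x = prodinf (\<lambda>m. 1 - x * var_q ^ m)"

definition qpoch :: "series \<Rightarrow> int \<Rightarrow> series" where
  "qpoch x n = qpoch_inf x / qpoch_inf (x * var_q powi n)"


datatype step = North_East | South_East | South | East

type_synonym point = "int \<times> int"

fun move :: "point \<Rightarrow> step \<Rightarrow> point" where
  "move (x, y) North_East = (x + 1, y + 1)"
| "move (x, y) South_East = (x + 1, y - 1)"
| "move (x, y) South = (x, y - 1)"
| "move (x, y) East = (x + 1, y)"

text \<open>
  A path is a starting point with its list of steps; its vertices are \<open>vertex P m\<close> for
  \<open>0 \<le> m \<le> length (snd P)\<close>, and step number \<open>m\<close> leads from \<open>vertex P m\<close> to \<open>vertex P (m + 1)\<close>.
\<close>

type_synonym path = "point \<times> step list"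

definition vertex :: "path \<Rightarrow> nat \<Rightarrow> point" where
  "vertex P m = foldl move (fst P) (take m (snd P))"

definition lattice_path :: "path \<Rightarrow> bool" where
  "lattice_path P \<longleftrightarrow>
     (let s = snd P; l = length s in
       (\<forall>m\<le>l. 0 \<le> fst (vertex P m) \<and> 0 \<le> snd (vertex P m)) \<and>
       fst (vertex P 0) = 0 \<and>
       snd (vertex P l) = 0 \<and>
       (\<forall>m<l. s ! m = East \<longrightarrow> snd (vertex P m) = 0) \<and>
       (\<forall>m<l. s ! m = South \<longrightarrow> 0 < m \<and> s ! (m - 1) = North_East) \<and>
       (s = [] \<or> last s = South_East \<or> last s = South))"

definition special_conditions :: "nat \<Rightarrow> nat \<Rightarrow> path \<Rightarrow> bool" where
  "special_conditions k i P \<longleftrightarrow>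
     vertex P 0 = (0, int k - int i) \<and>
     (\<forall>m\<le>length (snd P). snd (vertex P m) < int k)"

definition peaks :: "path \<Rightarrow> nat set" where
  "peaks P = {m. 0 < m \<and> m < length (snd P) \<and> snd P ! (m - 1) = North_East \<and>
                 (snd P ! m = South \<or> snd P ! m = South_East)}"

definition major_index :: "path \<Rightarrow> int" where
  "major_index P = (\<Sum>m\<in>peaks P. fst (vertex P m))"

definition south_steps :: "path \<Rightarrow> nat" where
  "south_steps P = count_list (snd P) South"

definition E_bar :: "nat \<Rightarrow> nat \<Rightarrow> nat \<Rightarrow> nat \<Rightarrow> nat" where
  "E_bar k i n j =
     card {P. lattice_path P \<and> special_conditions k i P \<and>
              major_index P = int n \<and> south_steps P = j}"

definition E_gf_term :: "nat \<Rightarrow> nat \<Rightarrow> nat \<times> nat \<Rightarrow> series" where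
  "E_gf_term k i = (\<lambda>(n, j). of_nat (E_bar k i n j) * var_q ^ n * var_a ^ j)"

definition E_gf :: "nat \<Rightarrow> nat \<Rightarrow> series" where
  "E_gf k i = infsum (E_gf_term k i) UNIV"

definition theta_term :: "nat \<Rightarrow> nat \<Rightarrow> int \<Rightarrow> series" where
  "theta_term k i n =
     (- 1) powi n * var_a powi n * var_q powi (int k * n\<^sup>2 + (int k - int i + 1) * n)
       * (qpoch (- 1 / var_a) n / qpoch (- var_a * var_q) n)"

end

theory Submission
  imports Defs
begin

text \<open>
  Reading a path from its first step gives, for the generating functions \<open>F\<^sub>h(N)\<close> of the paths with
  \<open>N\<close> peaks starting at height \<open>h\<close> and \<open>G\<^sub>h(N)\<close> of those whose start is moreover regarded as the end of
  a North-East step, the recurrences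
  \<open>F\<^sub>h(N) = q\<^sup>N (F\<^sub>h\<^sub>-\<^sub>1(N) + G\<^sub>h\<^sub>+\<^sub>1(N))\<close> and
  \<open>G\<^sub>h(N) = q\<^sup>N G\<^sub>h\<^sub>+\<^sub>1(N) + (a + q\<^sup>N\<^sup>-\<^sup>1) F\<^sub>h\<^sub>-\<^sub>1(N-1)\<close>, with boundary conditions
  \<open>F\<^sub>-\<^sub>1 = F\<^sub>0\<close> and \<open>G\<^sub>k = 0\<close>. They are solved by
  \<open>F\<^sub>h(N) = a\<^sup>N (-1/a)\<^sub>N \<Sum>\<^sub>n (-1)\<^sup>n q^(N(N+1)/2 + kn\<^sup>2 + (h+1)n - n(n+1)/2) / ((q)\<^sub>N\<^sub>-\<^sub>n (q)\<^sub>N\<^sub>+\<^sub>n)\<close>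
  and a similar sum for \<open>G\<close>; the boundary conditions hold because of the symmetries
  \<open>n \<mapsto> -n\<close> and \<open>n \<mapsto> -1-n\<close>. Summing over \<open>N\<close> first is an instance of
  \<open>\<^sub>1\<phi>\<^sub>1(C/z; C; q, z) = (z)\<^sub>\<infinity> / (C)\<^sub>\<infinity>\<close>, which in turn follows by telescoping from the functional equation
  relating \<open>(C, z)\<close> and \<open>(Cq, zq)\<close>.
\<close>

unbundle fps_syntax

declare fls_X_power_int [simp del]

subsection \<open>The \<open>q\<close>-adic topology\<close>

text \<open>A lower bound on the \<open>q\<close>-adic order, phrased by coefficients so that it
  also covers the zero series, whose \<open>fls_subdegree\<close> is 0 by convention.\<close>

definition vanishes_below :: "int \<Rightarrow> 'a::zero fls \<Rightarrow> bool" where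
  "vanishes_below n f \<longleftrightarrow> (\<forall>j<n. f $$ j = 0)"

lemma vanishes_below_mono: "vanishes_below n f \<Longrightarrow> m \<le> n \<Longrightarrow> vanishes_below m f"
  by (simp add: vanishes_below_def)

lemma vanishes_below_0 [simp]: "vanishes_below n 0"
  by (simp add: vanishes_below_def)

lemma vanishes_below_1 [simp]: "n \<le> 0 \<Longrightarrow> vanishes_below n 1"
  by (simp add: vanishes_below_def)

lemma vanishes_below_fls_const [simp]: "n \<le> 0 \<Longrightarrow> vanishes_below n (fls_const c)"
  by (simp add: vanishes_below_def)

lemma vanishes_below_add:
  "vanishes_below n f \<Longrightarrow> vanishes_below n g \<Longrightarrow> vanishes_below n (f + g :: 'a::monoid_add fls)"
  by (simp add: vanishes_below_def)

lemma vanishes_below_uminus [simp]: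
  "vanishes_below n (- f :: 'a::group_add fls) \<longleftrightarrow> vanishes_below n f"
  by (simp add: vanishes_below_def)

lemma vanishes_below_diff:
  "vanishes_below n f \<Longrightarrow> vanishes_below n g \<Longrightarrow> vanishes_below n (f - g :: 'a::group_add fls)"
  by (simp add: vanishes_below_def)

lemma vanishes_below_sum:
  "(\<And>x. x \<in> A \<Longrightarrow> vanishes_below n (f x)) \<Longrightarrow>
    vanishes_below n (\<Sum>x\<in>A. f x :: 'a::comm_monoid_add fls)"
  by (induction A rule: infinite_finite_induct) (auto intro: vanishes_below_add)

lemma vanishes_below_iff_subdegree:
  "vanishes_below n f \<longleftrightarrow> f = 0 \<or> n \<le> fls_subdegree f"
proof
  assume "vanishes_below n f"
  then show "f = 0 \<or> n \<le> fls_subdegree f"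
    by (auto simp: vanishes_below_def intro!: fls_subdegree_geI)
next
  assume "f = 0 \<or> n \<le> fls_subdegree f"
  then show "vanishes_below n f"
    by (auto simp: vanishes_below_def)
qed

lemma vanishes_below_mult:
  fixes f g :: "'a::{comm_monoid_add,mult_zero} fls"
  assumes "vanishes_below m f" and "vanishes_below n g" and "l \<le> m + n"
  shows "vanishes_below l (f * g)"
proof (cases "f = 0 \<or> g = 0")
  case False
  then show ?thesis
    using assms unfolding vanishes_below_iff_subdegree[of m] vanishes_below_iff_subdegree[of n]
    by (auto simp: vanishes_below_def intro!: fls_times_nth_eq0)
qed auto

lemma vanishes_below_prod:
  fixes f :: "'b \<Rightarrow> 'a::comm_semiring_1 fls"
  assumes "\<And>x. x \<in> A \<Longrightarrow> vanishes_below m (f x)"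
  shows "vanishes_below (m * int (card A)) (\<Prod>x\<in>A. f x)"
  using assms
  by (induction A rule: infinite_finite_induct)
     (auto intro: vanishes_below_mult simp: algebra_simps)

lemma vanishes_below_X_power_int [simp]:
  "vanishes_below n (fls_X powi m :: 'a::division_ring fls) \<longleftrightarrow> n \<le> m"
  by (auto simp: vanishes_below_iff_subdegree fls_X_power_int)

lemma vanishes_below_X_power [simp]:
  "vanishes_below n (fls_X ^ m :: 'a::{division_ring} fls) \<longleftrightarrow> n \<le> int m"
  using vanishes_below_X_power_int[of n "int m"] by (simp only: power_int_of_nat)

lemma vanishes_below_X [simp]:
  "vanishes_below n (fls_X :: 'a::division_ring fls) \<longleftrightarrow> n \<le> 1"
  using vanishes_below_X_power[of n 1] by (simp only: power_one_right) simp

text \<open>The hypotheses on \<open>g\<close> say that its order is exactly 0, so its inverse also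
  has order 0.\<close>

lemma vanishes_below_divide:
  fixes f g :: "'a::field fls"
  assumes "vanishes_below n f" and "vanishes_below 0 g" and "g $$ 0 \<noteq> 0"
  shows "vanishes_below n (f / g)"
proof -
  have "fls_subdegree g = 0"
    using assms(2,3) by (intro fls_subdegree_eqI) (auto simp: vanishes_below_def)
  then have "vanishes_below 0 (inverse g)"
    by (simp add: vanishes_below_iff_subdegree fls_inverse_subdegree)
  then show ?thesis
    using vanishes_below_mult[OF assms(1)] by (simp add: divide_inverse)
qed

lemma dist_fls_less_iff:
  fixes f g :: "'a::group_add fls"
  shows "dist f g < inverse (2 ^ n) \<longleftrightarrow> vanishes_below (int n + 1) (f - g)"
proof (cases "f = g")
  case False
  then have eq: "vanishes_below (int n + 1) (f - g) \<longleftrightarrow> int n + 1 \<le> fls_subdegree (f - g)"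
    by (simp add: vanishes_below_iff_subdegree)
  show ?thesis
  proof (cases "fls_subdegree (f - g) \<ge> 0")
    case True
    then show ?thesis
      unfolding eq using False by (auto simp: dist_fls_def)
  next
    case neg: False
    \<comment> \<open>A difference of negative order has distance at least 1, so neither side of the
      equivalence holds.\<close>
    have "inverse (2 ^ n) \<le> (1::real)"
      by (simp add: inverse_le_1_iff)
    also have "1 \<le> (2::real) ^ nat (- fls_subdegree (f - g))"
      by simp
    finally show ?thesis
      unfolding eq using False neg by (auto simp: dist_fls_def)
  qed
qed (simp add: dist_fls_def)

text \<open>Balls of radius \<open>inverse (2 ^ n)\<close> form a neighbourhood basis, so every
  later limit reduces to bounds on orders.\<close>

lemma tendsto_fls_iff:
  fixes f :: "'b \<Rightarrow> 'a::group_add fls"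
  shows "(f \<longlongrightarrow> L) F \<longleftrightarrow> (\<forall>n. eventually (\<lambda>x. vanishes_below n (f x - L)) F)"
proof
  assume lim: "(f \<longlongrightarrow> L) F"
  show "\<forall>n. eventually (\<lambda>x. vanishes_below n (f x - L)) F"
  proof
    fix n
    have "eventually (\<lambda>x. dist (f x) L < inverse (2 ^ nat n)) F"
      using lim by (intro tendstoD) auto
    then show "eventually (\<lambda>x. vanishes_below n (f x - L)) F"
      unfolding dist_fls_less_iff by (rule eventually_mono) (erule vanishes_below_mono, simp)
  qed
next
  assume *: "\<forall>n. eventually (\<lambda>x. vanishes_below n (f x - L)) F"
  show "(f \<longlongrightarrow> L) F"
  proof (rule tendstoI)
    fix e :: real assume "e > 0"
    then obtain n where n: "inverse (2 ^ n) < e"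
      using reals_power_lt_ex[of e 2] by (auto simp: field_simps)
    from * have "eventually (\<lambda>x. dist (f x) L < inverse (2 ^ n)) F"
      unfolding dist_fls_less_iff by blast
    then show "eventually (\<lambda>x. dist (f x) L < e) F"
      by (rule eventually_mono) (use n in simp)
  qed
qed

lemma eventually_nhds_fls:
  "eventually (\<lambda>f. vanishes_below n (f - g :: 'a::group_add fls)) (nhds g)"
  using tendsto_fls_iff[of "\<lambda>x. x" g "nhds g"] by (simp add: filterlim_ident)

text \<open>Opens the general laws of \<open>has_sum\<close>, such as summation over disjoint unions
  and over fibres, to series.\<close>

instance fls :: (ab_group_add) topological_ab_group_add
proof
  fix a b :: "'a fls"
  show "((\<lambda>x. fst x + snd x) \<longlongrightarrow> a + b) (nhds a \<times>\<^sub>F nhds b)"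
    unfolding tendsto_fls_iff
  proof
    fix n
    have "\<forall>\<^sub>F x in nhds a \<times>\<^sub>F nhds b. vanishes_below n (fst x - a) \<and> vanishes_below n (snd x - b)"
      using eventually_prodI[OF eventually_nhds_fls[of n a] eventually_nhds_fls[of n b]] .
    then show "\<forall>\<^sub>F x in nhds a \<times>\<^sub>F nhds b. vanishes_below n (fst x + snd x - (a + b))"
    proof (rule eventually_mono)
      fix x assume "vanishes_below n (fst x - a) \<and> vanishes_below n (snd x - b)"
      then have "vanishes_below n ((fst x - a) + (snd x - b))"
        by (blast intro: vanishes_below_add)
      then show "vanishes_below n (fst x + snd x - (a + b))"
        by (simp add: algebra_simps)
    qed
  qed
next
  fix a :: "'a fls"
  show "(uminus \<longlongrightarrow> - a) (nhds a)"
    unfolding tendsto_fls_iff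
  proof
    fix n
    show "\<forall>\<^sub>F x in nhds a. vanishes_below n (- x - - a)"
      using eventually_nhds_fls[of n a]
    proof (rule eventually_mono)
      fix x assume "vanishes_below n (x - a)"
      then show "vanishes_below n (- x - - a)" by (simp add: vanishes_below_def)
    qed
  qed
qed

instance fls :: (comm_ring) topological_semigroup_mult
proof
  fix a b :: "'a fls"
  show "((\<lambda>x. fst x * snd x) \<longlongrightarrow> a * b) (nhds a \<times>\<^sub>F nhds b)"
    unfolding tendsto_fls_iff
  proof
    fix n
    \<comment> \<open>\<open>d\<close> bounds the pole orders of \<open>a\<close> and
      \<open>b\<close>. In \<open>m\<close>, the part \<open>n + d\<close> compensates for the pole
      of the other factor, and \<open>- d\<close> keeps the pole order of the nearby
      \<open>fst x\<close> within \<open>d\<close>.\<close>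
    define d where "d = max 0 (max (- fls_subdegree a) (- fls_subdegree b))"
    have a: "vanishes_below (- d) a" and b: "vanishes_below (- d) b"
      by (auto simp: vanishes_below_iff_subdegree d_def)
    define m where "m = max (n + d) (- d)"
    have "\<forall>\<^sub>F x in nhds a \<times>\<^sub>F nhds b. vanishes_below m (fst x - a) \<and> vanishes_below m (snd x - b)"
      using eventually_prodI[OF eventually_nhds_fls[of m a] eventually_nhds_fls[of m b]] .
    then show "\<forall>\<^sub>F x in nhds a \<times>\<^sub>F nhds b. vanishes_below n (fst x * snd x - a * b)"
    proof (rule eventually_mono)
      fix x assume "vanishes_below m (fst x - a) \<and> vanishes_below m (snd x - b)"
      then have x: "vanishes_below m (fst x - a)" "vanishes_below m (snd x - b)" by auto
      have "vanishes_below (- d) ((fst x - a) + a)"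
        using x(1) a by (intro vanishes_below_add) (auto elim: vanishes_below_mono simp: m_def)
      then have "vanishes_below (- d) (fst x)" by simp
      then have "vanishes_below n (fst x * (snd x - b) + (fst x - a) * b)"
        by (intro vanishes_below_add vanishes_below_mult[where m = "- d" and n = m]
              vanishes_below_mult[where m = m and n = "- d"] x b) (auto simp: m_def)
      then show "vanishes_below n (fst x * snd x - a * b)"
        by (simp add: algebra_simps)
    qed
  qed
qed

section \<open>Closed conditions and unconditional summation in the \<open>q\<close>-adic
  topology\<close>

lemma tendsto_vanishes_below:
  fixes f :: "'b \<Rightarrow> 'a::group_add fls"
  assumes "(f \<longlongrightarrow> L) F" and "eventually (\<lambda>x. vanishes_below n (f x)) F" and "F \<noteq> bot"
  shows "vanishes_below n L"
proof -
  have "eventually (\<lambda>x. vanishes_below n (f x - L)) F"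
    using assms(1) by (simp add: tendsto_fls_iff)
  with assms(2) have "eventually (\<lambda>x. vanishes_below n L) F"
  proof eventually_elim
    case (elim x)
    then show ?case by (simp add: vanishes_below_def)
  qed
  with assms(3) show ?thesis by simp
qed

text \<open>The nonarchimedean criterion: each coefficient of the sum receives only finitely many
  contributions, and no Cauchy argument is required.\<close>

lemma fls_summable_on:
  fixes f :: "'b \<Rightarrow> 'a::ab_group_add fls"
  assumes fin: "\<And>n. finite {x\<in>A. \<not> vanishes_below n (f x)}"
  shows "f summable_on A"
proof -
  define B where "B n = {x\<in>A. \<not> vanishes_below (n + 1) (f x)}" for n
  have finB: "finite (B n)" for n
    unfolding B_def by (rule fin)
  define c where "c n = (\<Sum>x\<in>B n. f x $$ n)" for n
  have c: "c j = (\<Sum>x\<in>X. f x $$ j)" if "finite X" "B n \<subseteq> X" "X \<subseteq> A" "j \<le> n" for j n X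
    unfolding c_def
  proof (rule sum.mono_neutral_left[OF that(1)])
    show "B j \<subseteq> X"
      using that(2,4) vanishes_below_mono[of "n + 1" _ "j + 1"] by (auto simp: B_def)
    show "\<forall>x\<in>X - B j. f x $$ j = 0"
      using that(3) by (auto simp: B_def vanishes_below_def)
  qed
  \<comment> \<open>Coefficients of negative index come only from members in \<open>B 0\<close>, so
    their least order bounds the support of \<open>c\<close> from below. The inserted 0 covers an
    empty \<open>B 0\<close> and ensures \<open>d \<le> 0\<close>.\<close>
  define d where "d = Min (insert 0 ((\<lambda>x. fls_subdegree (f x)) ` B 0))"
  have "c j = 0" if "j < d" for j
  proof -
    have d: "d \<le> 0" "x \<in> B 0 \<Longrightarrow> d \<le> fls_subdegree (f x)" for x
      unfolding d_def using finB[of 0] by (auto intro!: Min_le)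
    have "c j = (\<Sum>x\<in>B 0. f x $$ j)"
      by (rule c[of _ 0]) (use that d(1) finB[of 0] in \<open>auto simp: B_def\<close>)
    also have "\<dots> = 0"
      using d(2) that by (intro sum.neutral) fastforce
    finally show ?thesis .
  qed
  then have nth: "Abs_fls c $$ j = c j" for j
    by (intro nth_Abs_fls_lower_bound) auto
  have "(sum f \<longlongrightarrow> Abs_fls c) (finite_subsets_at_top A)"
    unfolding tendsto_fls_iff eventually_finite_subsets_at_top
  proof (intro allI exI conjI impI)
    fix n Y assume Y: "finite Y \<and> B n \<subseteq> Y \<and> Y \<subseteq> A"
    show "vanishes_below n (sum f Y - Abs_fls c)"
      using c[of Y n] Y by (simp add: vanishes_below_def nth fls_nth_sum)
  qed (use finB in \<open>auto simp: B_def\<close>)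
  then show ?thesis
    by (auto simp: summable_on_def has_sum_def)
qed

text \<open>Regroups a sum over words by a statistic: the pair of major index and number of South
  steps, or the number of peaks.\<close>

lemma has_sum_fibres:
  fixes f :: "'b \<Rightarrow> 'a::{topological_comm_monoid_add,t3_space}"
  assumes "(f has_sum S) A" and "\<And>y. (f has_sum g y) {x\<in>A. key x = y}"
  shows "(g has_sum S) UNIV"
proof (rule has_sum_SigmaD[where B = "\<lambda>y. {x\<in>A. key x = y}" and f = "\<lambda>(y, x). f x"])
  have "bij_betw (\<lambda>x. (key x, x)) A (SIGMA y:UNIV. {x\<in>A. key x = y})"
    by (rule bij_betwI[where g = snd]) auto
  then show "((\<lambda>(y, x). f x) has_sum S) (SIGMA y:UNIV. {x\<in>A. key x = y})"
    using has_sum_reindex_bij_betw[of "\<lambda>x. (key x, x)" A _ "\<lambda>(y, x). f x" S] assms(1) by auto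
qed (use assms(2) in auto)

subsection \<open>Shifted factorials\<close>

definition qpoch_fin :: "series \<Rightarrow> nat \<Rightarrow> series" where
  "qpoch_fin x n = (\<Prod>j<n. 1 - x * var_q ^ j)"

lemma qpoch_fin_0 [simp]: "qpoch_fin x 0 = 1"
  by (simp add: qpoch_fin_def)

lemma qpoch_fin_Suc: "qpoch_fin x (Suc n) = qpoch_fin x n * (1 - x * var_q ^ n)"
  by (simp add: qpoch_fin_def)

lemma qpoch_fin_add: "qpoch_fin x (m + n) = qpoch_fin x m * qpoch_fin (x * var_q ^ m) n"
  by (induction n) (simp_all add: qpoch_fin_Suc power_add mult_ac)

lemma qpoch_fin_Suc': "qpoch_fin x (Suc n) = (1 - x) * qpoch_fin (x * var_q) n"
  using qpoch_fin_add[of x 1 n] by (simp add: qpoch_fin_Suc)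

lemma vanishes_below_qpoch_fin: "vanishes_below 1 x \<Longrightarrow> vanishes_below 0 (qpoch_fin x n)"
  unfolding qpoch_fin_def
  by (rule vanishes_below_prod[where m = 0 and A = "{..<n}", simplified])
     (auto intro!: vanishes_below_diff vanishes_below_mult[where m = 1 and n = 0])

text \<open>Splitting off the constant term of \<open>f\<close> leaves a series of order at least 1,
  which contributes nothing to coefficient 0.\<close>

lemma fls_mult_nth_0_of_vanishing:
  fixes f g :: "'a::comm_ring_1 fls"
  assumes "vanishes_below 0 f" and "vanishes_below 0 g"
  shows "(f * g) $$ 0 = f $$ 0 * g $$ 0"
proof -
  define f' where "f' = f - fls_const (f $$ 0)"
  have "vanishes_below 1 f'"
    using assms(1) by (auto simp: f'_def vanishes_below_def)
  then have "vanishes_below 1 (f' * g)"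
    by (rule vanishes_below_mult[OF _ assms(2)]) simp
  then have "(f' * g) $$ 0 = 0"
    by (simp add: vanishes_below_def)
  moreover have "f = fls_const (f $$ 0) + f'"
    by (simp add: f'_def)
  ultimately show ?thesis
    by (metis (no_types, lifting) add.right_neutral distrib_right fls_mult_const_nth(1) fls_plus_nth)
qed

lemma qpoch_fin_nth_0: "vanishes_below 1 x \<Longrightarrow> qpoch_fin x n $$ 0 = 1"
proof (induction n)
  case (Suc n)
  have "vanishes_below 1 (x * var_q ^ n)"
    using Suc.prems by (rule vanishes_below_mult[where n = 0]) auto
  then have "(1 - x * var_q ^ n) $$ 0 = 1" "vanishes_below 0 (1 - x * var_q ^ n)"
    by (auto simp: vanishes_below_def)
  then show ?case
    using Suc by (simp add: qpoch_fin_Suc fls_mult_nth_0_of_vanishing vanishes_below_qpoch_fin)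
qed simp

lemma qpoch_fin_nonzero: "vanishes_below 1 x \<Longrightarrow> qpoch_fin x n \<noteq> 0"
  using qpoch_fin_nth_0[of x n] by auto

lemma vanishes_below_divide_qpoch_fin:
  "vanishes_below 1 x \<Longrightarrow> vanishes_below n f \<Longrightarrow> vanishes_below n (f / qpoch_fin x m)"
  by (rule vanishes_below_divide) (simp_all add: vanishes_below_qpoch_fin qpoch_fin_nth_0)

lemma tendsto_fls_0I:
  fixes f :: "nat \<Rightarrow> 'a::group_add fls"
  assumes "\<And>n. vanishes_below (int n) (f n)"
  shows "f \<longlonglongrightarrow> 0"
  unfolding tendsto_fls_iff
proof
  fix m :: int
  show "eventually (\<lambda>n. vanishes_below m (f n - 0)) sequentially"
    using eventually_ge_at_top[of "nat m"]
  proof eventually_elim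
    case (elim n)
    then show ?case using vanishes_below_mono[OF assms[of n], of m] by simp
  qed
qed

lemma fls_summable_on_nat:
  fixes f :: "nat \<Rightarrow> 'a::ab_group_add fls"
  assumes "\<And>n. vanishes_below (int n) (f n)"
  shows "f summable_on UNIV"
proof (rule fls_summable_on)
  fix m :: int
  have "{n. \<not> vanishes_below m (f n)} \<subseteq> {..<nat m}"
  proof
    fix n assume "n \<in> {n. \<not> vanishes_below m (f n)}"
    then show "n \<in> {..<nat m}"
      using vanishes_below_mono[OF assms[of n], of m] by (cases "m \<le> int n") auto
  qed
  then show "finite {n \<in> UNIV. \<not> vanishes_below m (f n)}"
    by (auto intro: finite_subset)
qed

text \<open>Consecutive products differ by a series of order at least \<open>n\<close>, so the
  telescoping series converges. All partial products have constant term 1, hence the limit is not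
  0.\<close>

lemma qpoch_fin_convergent:
  assumes "vanishes_below 1 x"
  obtains L where "qpoch_fin x \<longlonglongrightarrow> L" and "L \<noteq> 0"
proof -
  have "(\<lambda>n. qpoch_fin x (Suc n) - qpoch_fin x n) summable_on UNIV"
  proof (rule fls_summable_on_nat)
    fix n
    have "vanishes_below (int n) (- (qpoch_fin x n * (x * var_q ^ n)))"
      unfolding vanishes_below_uminus
      by (intro vanishes_below_mult[OF vanishes_below_qpoch_fin[OF assms], where n = "int n"]
            vanishes_below_mult[OF assms, where n = "int n"]) auto
    then show "vanishes_below (int n) (qpoch_fin x (Suc n) - qpoch_fin x n)"
      by (simp add: qpoch_fin_Suc algebra_simps)
  qed
  then obtain S where "((\<lambda>n. qpoch_fin x (Suc n) - qpoch_fin x n) has_sum S) UNIV"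
    by (auto simp: summable_on_def)
  then have "(\<lambda>n. \<Sum>i<n. qpoch_fin x (Suc i) - qpoch_fin x i) \<longlonglongrightarrow> S"
    by (auto dest!: has_sum_imp_sums simp: sums_def)
  then have "(\<lambda>n. (qpoch_fin x n - 1) + 1) \<longlonglongrightarrow> S + 1"
    unfolding sum_lessThan_telescope by (intro tendsto_add) auto
  then have lim: "qpoch_fin x \<longlonglongrightarrow> S + 1"
    by simp
  moreover have "S + 1 \<noteq> 0"
  proof
    assume "S + 1 = 0"
    with lim have "eventually (\<lambda>n. vanishes_below 1 (qpoch_fin x n)) sequentially"
      by (simp add: tendsto_fls_iff)
    then obtain n where "vanishes_below 1 (qpoch_fin x n)"
      by (auto simp: eventually_sequentially)
    then show False
      using qpoch_fin_nth_0[OF assms, of n] by (auto simp: vanishes_below_def)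
  qed
  ultimately show ?thesis using that by blast
qed

text \<open>The value of \<open>prodinf\<close> is read off from the limit of partial products only
  when that limit is nonzero, so both facts are obtained together.\<close>

lemma
  assumes "vanishes_below 1 x"
  shows tendsto_qpoch_inf_of_vanishing: "qpoch_fin x \<longlonglongrightarrow> qpoch_inf x"
    and qpoch_inf_nonzero_of_vanishing: "qpoch_inf x \<noteq> 0"
proof -
  obtain L where L: "qpoch_fin x \<longlonglongrightarrow> L" "L \<noteq> 0"
    using qpoch_fin_convergent[OF assms] .
  then have "qpoch_inf x = L"
    unfolding qpoch_inf_def using prodinf_eq_prod_lim'[of "\<lambda>m. 1 - x * var_q ^ m" L]
    by (simp add: qpoch_fin_def[abs_def])
  with L show "qpoch_fin x \<longlonglongrightarrow> qpoch_inf x" "qpoch_inf x \<noteq> 0" by auto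
qed

text \<open>Arguments such as \<open>- 1 / var_a * var_q powi n\<close> may have order 0 or less.
  Splitting off finitely many factors, none of them zero by hypothesis, leaves an argument of
  positive order.\<close>

lemma
  assumes "\<And>m. x * var_q ^ m \<noteq> 1"
  shows tendsto_qpoch_inf: "qpoch_fin x \<longlonglongrightarrow> qpoch_inf x"
    and qpoch_inf_nonzero: "qpoch_inf x \<noteq> 0"
proof -
  define M where "M = nat (1 - fls_subdegree x)"
  have vb: "vanishes_below 1 (x * var_q ^ M)"
    by (rule vanishes_below_mult[where m = "fls_subdegree x" and n = "int M"])
       (auto simp: vanishes_below_iff_subdegree[of _ x] M_def)
  have "(\<lambda>n. qpoch_fin x M * qpoch_fin (x * var_q ^ M) n)
      \<longlonglongrightarrow> qpoch_fin x M * qpoch_inf (x * var_q ^ M)"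
    by (intro tendsto_mult_left tendsto_qpoch_inf_of_vanishing vb)
  then have "(\<lambda>n. qpoch_fin x (n + M)) \<longlonglongrightarrow> qpoch_fin x M * qpoch_inf (x * var_q ^ M)"
    by (simp add: add.commute[of _ M] qpoch_fin_add)
  then have L: "qpoch_fin x \<longlonglongrightarrow> qpoch_fin x M * qpoch_inf (x * var_q ^ M)"
    by (rule LIMSEQ_offset)
  have nz: "qpoch_fin x M * qpoch_inf (x * var_q ^ M) \<noteq> 0"
    using assms qpoch_inf_nonzero_of_vanishing[OF vb] by (auto simp: qpoch_fin_def)
  have "qpoch_inf x = qpoch_fin x M * qpoch_inf (x * var_q ^ M)"
    unfolding qpoch_inf_def[of x] 
    using prodinf_eq_prod_lim'[of "\<lambda>m. 1 - x * var_q ^ m"] L nz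
    by (simp add: qpoch_fin_def[abs_def])
  with L nz show "qpoch_fin x \<longlonglongrightarrow> qpoch_inf x" "qpoch_inf x \<noteq> 0" by auto
qed

lemma mult_X_power_neq_1:
  assumes "vanishes_below 1 (x::series)"
  shows "x * var_q ^ m \<noteq> 1"
proof
  assume "x * var_q ^ m = 1"
  moreover have "vanishes_below 1 (x * var_q ^ m)"
    by (rule vanishes_below_mult[OF assms, where n = 0]) auto
  ultimately have "(1::series) $$ 0 = 0"
    unfolding vanishes_below_def by (metis zero_less_one)
  then show False by simp
qed

lemma qpoch_inf_split:
  assumes "\<And>m. x * var_q ^ m \<noteq> 1"
  shows "qpoch_inf x = qpoch_fin x n * qpoch_inf (x * var_q ^ n)"
proof (rule LIMSEQ_unique)
  have "\<And>m. x * var_q ^ n * var_q ^ m \<noteq> 1"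
    using assms[of "n + _"] by (simp add: power_add mult.assoc)
  then have "(\<lambda>m. qpoch_fin x n * qpoch_fin (x * var_q ^ n) m)
      \<longlonglongrightarrow> qpoch_fin x n * qpoch_inf (x * var_q ^ n)"
    by (intro tendsto_mult_left tendsto_qpoch_inf)
  then show "(\<lambda>m. qpoch_fin x (m + n)) \<longlonglongrightarrow> qpoch_fin x n * qpoch_inf (x * var_q ^ n)"
    by (simp add: add.commute[of _ n] qpoch_fin_add)
  show "(\<lambda>m. qpoch_fin x (m + n)) \<longlonglongrightarrow> qpoch_inf x"
    by (rule LIMSEQ_ignore_initial_segment[OF tendsto_qpoch_inf[OF assms]])
qed

subsection \<open>The summation of \<open>\<^sub>1\<phi>\<^sub>1\<close>\<close>

text \<open>The factor \<open>(C/z)\<^sub>m (-z)\<^sup>m\<close> of the general term of \<open>\<^sub>1\<phi>\<^sub>1(C/z; C; q, z)\<close> is written as a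
  polynomial in \<open>z\<close>.\<close>

definition phi_term :: "series \<Rightarrow> series \<Rightarrow> nat \<Rightarrow> series" where
  "phi_term C z m = (\<Prod>j<m. C * var_q ^ j - z) * var_q ^ (m choose 2)
     / (qpoch_fin var_q m * qpoch_fin C m)"

lemma vanishes_below_phi_factor:
  assumes "vanishes_below d C" and "vanishes_below d z"
  shows "vanishes_below (d * int m) (\<Prod>j<m. C * var_q ^ j - z)"
  by (rule vanishes_below_prod[where A = "{..<m}", simplified])
     (use assms in \<open>auto intro!: vanishes_below_diff vanishes_below_mult[where m = d and n = 0]\<close>)

lemma vanishes_below_phi_term:
  assumes "vanishes_below d C" and "vanishes_below d z" and "1 \<le> d"
  shows "vanishes_below (d * int m) (phi_term C z m)"
  unfolding phi_term_def divide_divide_eq_left[symmetric]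
  by (intro vanishes_below_divide_qpoch_fin vanishes_below_mult[OF vanishes_below_phi_factor[OF assms(1,2)], where n = 0])
     (use assms vanishes_below_mono in auto)

text \<open>Truncated form of the functional equation relating \<open>(C, z)\<close> to
  \<open>(C * var_q, z * var_q)\<close>: the two partial sums cancel up to one boundary
  term.\<close>

lemma phi_telescope:
  assumes "vanishes_below 1 C"
  shows "(1 - C) * (\<Sum>m<Suc n. phi_term C z m) - (1 - z) * (\<Sum>m<Suc n. phi_term (C * var_q) (z * var_q) m)
    = - ((\<Prod>j<Suc n. C * var_q ^ j - z) * var_q ^ (Suc n choose 2)
        / (qpoch_fin var_q n * qpoch_fin (C * var_q) n))"
proof (induction n)
  case 0
  show ?case by (simp add: phi_term_def numeral_2_eq_2)
next
  case (Suc n)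
  define Q where "Q = var_q ^ Suc n"
  define P where "P = (\<Prod>j<Suc n. C * var_q ^ j - z)"
  define b where "b = var_q ^ (Suc n choose 2)"
  have Cq: "vanishes_below 1 (C * var_q)"
    by (rule vanishes_below_mult[OF assms, where n = 1]) auto
  have nz: "qpoch_fin var_q (Suc n) \<noteq> 0" "qpoch_fin C (Suc n) \<noteq> 0" "qpoch_fin (C * var_q) (Suc n) \<noteq> 0"
    using assms Cq by (auto intro!: qpoch_fin_nonzero)
  define u v where "u = qpoch_fin var_q n" and "v = qpoch_fin (C * var_q) n"
  have uS: "qpoch_fin var_q (Suc n) = u * (1 - Q)" and vS: "qpoch_fin (C * var_q) (Suc n) = v * (1 - C * Q)"
    by (simp_all add: qpoch_fin_Suc u_def v_def Q_def mult_ac)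
  have CS: "qpoch_fin C (Suc n) = (1 - C) * v"
    by (simp add: qpoch_fin_Suc' v_def)
  have nz': "u \<noteq> 0" "v \<noteq> 0" "1 - Q \<noteq> 0" "1 - C * Q \<noteq> 0" "1 - C \<noteq> 0"
    using nz uS vS CS by auto
  have t1: "phi_term C z (Suc n) = P * b / (u * (1 - Q) * ((1 - C) * v))"
    by (simp only: phi_term_def P_def b_def uS CS)
  have "(\<Prod>j<Suc n. C * var_q * var_q ^ j - z * var_q) = (\<Prod>j<Suc n. var_q * (C * var_q ^ j - z))"
    by (intro prod.cong) (simp_all add: algebra_simps)
  also have "\<dots> = Q * P"
    by (simp only: prod.distrib prod_constant card_lessThan P_def Q_def)
  finally have t2: "phi_term (C * var_q) (z * var_q) (Suc n) = Q * P * b / (u * (1 - Q) * (v * (1 - C * Q)))"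
    by (simp only: phi_term_def b_def uS vS)
  have P': "(\<Prod>j<Suc (Suc n). C * var_q ^ j - z) = P * (C * Q - z)"
    by (simp add: P_def Q_def)
  have b': "var_q ^ (Suc (Suc n) choose 2) = b * Q"
    by (simp add: b_def Q_def power_add[symmetric] numeral_2_eq_2 add_ac)
  have "(1 - C) * (\<Sum>m<Suc (Suc n). phi_term C z m) - (1 - z) * (\<Sum>m<Suc (Suc n). phi_term (C * var_q) (z * var_q) m)
    = - (P * b / (u * v)) + ((1 - C) * phi_term C z (Suc n) - (1 - z) * phi_term (C * var_q) (z * var_q) (Suc n))"
    using Suc unfolding P_def[symmetric] b_def[symmetric] u_def[symmetric] v_def[symmetric]
    by (simp only: sum.lessThan_Suc[of _ "Suc n"] distrib_left) (simp only: algebra_simps)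
  \<comment> \<open>With the common factors cleared this is \<open>(1 - C * Q) - (1 - z) * Q - (1 -
    Q) * (1 - C * Q) = - (C * Q - z) * Q\<close>.\<close>
  also have "\<dots> = - (P * (C * Q - z) * (b * Q) / ((u * (1 - Q)) * (v * (1 - C * Q))))"
    unfolding t1 t2 using nz' by (simp add: divide_simps) (simp add: algebra_simps)
  finally show ?case unfolding P' b' uS vS .
qed

lemma phi_term_summable_on:
  assumes "vanishes_below 1 C" and "vanishes_below 1 z"
  shows "phi_term C z summable_on UNIV"
  by (rule fls_summable_on_nat) (use vanishes_below_phi_term[OF assms] in auto)

text \<open>The boundary term of \<open>phi_telescope\<close> contains \<open>Suc n\<close> factors
  of order at least 1, so it tends to 0.\<close>

lemma phi_shift:
  assumes C: "vanishes_below 1 C" and z: "vanishes_below 1 z"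
  shows "(1 - C) * infsum (phi_term C z) UNIV
    = (1 - z) * infsum (phi_term (C * var_q) (z * var_q)) UNIV"
proof -
  have Cq: "vanishes_below 1 (C * var_q)" and zq: "vanishes_below 1 (z * var_q)"
    using vanishes_below_mult[OF C, of 1 var_q] vanishes_below_mult[OF z, of 1 var_q] by auto
  have lim: "(\<lambda>n. \<Sum>m<Suc n. phi_term C z m) \<longlonglongrightarrow> infsum (phi_term C z) UNIV"
    if "vanishes_below 1 C" "vanishes_below 1 z" for C z
    using has_sum_imp_sums[OF has_sum_infsum[OF phi_term_summable_on[OF that]]]
    unfolding sums_def by (rule LIMSEQ_Suc)
  let ?u = "\<lambda>n. - ((\<Prod>j<Suc n. C * var_q ^ j - z) * var_q ^ (Suc n choose 2)
        / (qpoch_fin var_q n * qpoch_fin (C * var_q) n))"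
  have "?u \<longlonglongrightarrow> 0"
  proof (rule tendsto_fls_0I)
    fix n
    have "vanishes_below (int (Suc n)) (\<Prod>j<Suc n. C * var_q ^ j - z)"
      using vanishes_below_phi_factor[OF C z, of "Suc n"] by simp
    then have "vanishes_below (int n) ((\<Prod>j<Suc n. C * var_q ^ j - z) * var_q ^ (Suc n choose 2))"
      by (rule vanishes_below_mult[where n = 0]) auto
    then show "vanishes_below (int n) (?u n)"
      unfolding vanishes_below_uminus divide_divide_eq_left[symmetric]
      by (intro vanishes_below_divide_qpoch_fin Cq) auto
  qed
  moreover have "?u \<longlonglongrightarrow> (1 - C) * infsum (phi_term C z) UNIV
      - (1 - z) * infsum (phi_term (C * var_q) (z * var_q)) UNIV"
    unfolding phi_telescope[OF C, symmetric]
    by (intro tendsto_diff tendsto_mult_left lim C z Cq zq)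
  ultimately show ?thesis
    using LIMSEQ_unique by fastforce
qed

lemma phi_shift_n:
  assumes C: "vanishes_below 1 C" and z: "vanishes_below 1 z"
  shows "qpoch_fin C n * infsum (phi_term C z) UNIV
    = qpoch_fin z n * infsum (phi_term (C * var_q ^ n) (z * var_q ^ n)) UNIV"
proof (induction n)
  case (Suc n)
  have *: "vanishes_below 1 (C * var_q ^ n)" "vanishes_below 1 (z * var_q ^ n)"
    using vanishes_below_mult[OF C, of 0 "var_q ^ n" 1] vanishes_below_mult[OF z, of 0 "var_q ^ n" 1] by auto
  have "qpoch_fin C (Suc n) * infsum (phi_term C z) UNIV
    = (qpoch_fin C n * infsum (phi_term C z) UNIV) * (1 - C * var_q ^ n)"
    by (simp add: qpoch_fin_Suc mult_ac)
  also have "\<dots> = qpoch_fin z n * ((1 - C * var_q ^ n) * infsum (phi_term (C * var_q ^ n) (z * var_q ^ n)) UNIV)"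
    unfolding Suc by (simp add: mult_ac)
  also have "\<dots> = qpoch_fin z (Suc n) * infsum (phi_term (C * var_q ^ Suc n) (z * var_q ^ Suc n)) UNIV"
    unfolding phi_shift[OF *] by (simp add: qpoch_fin_Suc mult_ac)
  finally show ?case .
qed simp

text \<open>After the shift by \<open>n\<close>, the term with index \<open>m\<close> has order at
  least \<open>(n + 1) * m\<close>; only the term 1 at \<open>m = 0\<close> survives in the
  limit.\<close>

lemma phi_tendsto_1:
  assumes C: "vanishes_below 1 C" and z: "vanishes_below 1 z"
  shows "(\<lambda>n. infsum (phi_term (C * var_q ^ n) (z * var_q ^ n)) UNIV) \<longlonglongrightarrow> 1"
proof -
  let ?\<Phi> = "\<lambda>n. infsum (phi_term (C * var_q ^ n) (z * var_q ^ n)) UNIV"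
  have "(\<lambda>n. ?\<Phi> n - 1) \<longlonglongrightarrow> 0"
  proof (rule tendsto_fls_0I)
    fix n
    have *: "vanishes_below (int (Suc n)) (C * var_q ^ n)" "vanishes_below (int (Suc n)) (z * var_q ^ n)"
      using vanishes_below_mult[OF C, of n "var_q ^ n"] vanishes_below_mult[OF z, of n "var_q ^ n"] by auto
    then have **: "vanishes_below 1 (C * var_q ^ n)" "vanishes_below 1 (z * var_q ^ n)"
      by (auto elim: vanishes_below_mono)
    have "(\<lambda>M. (\<Sum>m<Suc M. phi_term (C * var_q ^ n) (z * var_q ^ n) m) - 1) \<longlonglongrightarrow> ?\<Phi> n - 1"
      using has_sum_imp_sums[OF has_sum_infsum[OF phi_term_summable_on[OF **]]]
      unfolding sums_def by (intro tendsto_diff tendsto_const LIMSEQ_Suc)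
    then show "vanishes_below (int n) (?\<Phi> n - 1)"
    proof (rule tendsto_vanishes_below)
      have "vanishes_below (int n) (\<Sum>m<M. phi_term (C * var_q ^ n) (z * var_q ^ n) (Suc m))" for M
      proof (rule vanishes_below_sum)
        fix m
        have "int n \<le> int (Suc n) * int (Suc m)"
          unfolding of_nat_mult[symmetric] of_nat_le_iff by simp
        then show "vanishes_below (int n) (phi_term (C * var_q ^ n) (z * var_q ^ n) (Suc m))"
          using vanishes_below_phi_term[OF *, of "Suc m"] by (auto elim: vanishes_below_mono)
      qed
      then show "\<forall>\<^sub>F M in sequentially. vanishes_below (int n)
          ((\<Sum>m<Suc M. phi_term (C * var_q ^ n) (z * var_q ^ n) m) - 1)"
        unfolding sum.lessThan_Suc_shift by (simp add: phi_term_def numeral_2_eq_2)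
    qed auto
  qed
  then have "(\<lambda>n. (?\<Phi> n - 1) + 1) \<longlonglongrightarrow> 0 + 1"
    by (intro tendsto_add tendsto_const)
  then show ?thesis by simp
qed

text \<open>Letting \<open>n\<close> tend to infinity in \<open>phi_shift_n\<close> turns the finite
  products into infinite ones and the shifted sum into 1.\<close>

lemma phi_term_has_sum:
  assumes C: "vanishes_below 1 C" and z: "vanishes_below 1 z"
  shows "(phi_term C z has_sum qpoch_inf z / qpoch_inf C) UNIV"
proof -
  have "(\<lambda>n. qpoch_fin C n * infsum (phi_term C z) UNIV) \<longlonglongrightarrow> qpoch_inf C * infsum (phi_term C z) UNIV"
    by (intro tendsto_mult_right tendsto_qpoch_inf_of_vanishing C)
  moreover have "(\<lambda>n. qpoch_fin C n * infsum (phi_term C z) UNIV) \<longlonglongrightarrow> qpoch_inf z * 1"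
    unfolding phi_shift_n[OF C z]
    by (intro tendsto_mult tendsto_qpoch_inf_of_vanishing z phi_tendsto_1 C)
  ultimately have "qpoch_inf C * infsum (phi_term C z) UNIV = qpoch_inf z"
    using LIMSEQ_unique by fastforce
  then have "infsum (phi_term C z) UNIV = qpoch_inf z / qpoch_inf C"
    using qpoch_inf_nonzero_of_vanishing[OF C] by (simp add: field_simps)
  then show ?thesis
    using phi_term_summable_on[OF C z] by (metis has_sum_infsum)
qed

subsection \<open>Lattice paths as words\<close>

text \<open>The flag \<open>b\<close> records whether the preceding step was North-East, so that the starting point
  counts as a peak if \<open>b\<close> holds and the path goes down; \<open>x\<close> is the abscissa of the starting point.\<close>

fun admissible :: "nat \<Rightarrow> bool \<Rightarrow> nat \<Rightarrow> step list \<Rightarrow> bool" where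
  "admissible k b h [] \<longleftrightarrow> h < k \<and> h = 0"
| "admissible k b h (North_East # s) \<longleftrightarrow> h < k \<and> admissible k True (Suc h) s"
| "admissible k b h (South_East # s) \<longleftrightarrow> h < k \<and> 0 < h \<and> admissible k False (h - 1) s"
| "admissible k b h (South # s) \<longleftrightarrow> h < k \<and> 0 < h \<and> b \<and> admissible k False (h - 1) s"
| "admissible k b h (East # s) \<longleftrightarrow> h < k \<and> h = 0 \<and> s \<noteq> [] \<and> admissible k False 0 s"

fun num_peaks :: "bool \<Rightarrow> step list \<Rightarrow> nat" where
  "num_peaks b [] = 0"
| "num_peaks b (North_East # s) = num_peaks True s"
| "num_peaks b (South_East # s) = of_bool b + num_peaks False s"
| "num_peaks b (South # s) = of_bool b + num_peaks False s"
| "num_peaks b (East # s) = num_peaks False s"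

fun maj :: "bool \<Rightarrow> nat \<Rightarrow> step list \<Rightarrow> nat" where
  "maj b x [] = 0"
| "maj b x (North_East # s) = maj True (Suc x) s"
| "maj b x (South_East # s) = of_bool b * x + maj False (Suc x) s"
| "maj b x (South # s) = of_bool b * x + maj False x s"
| "maj b x (East # s) = maj False (Suc x) s"

section \<open>Translation between paths with vertices and admissible words\<close>

lemma vertex_0: "vertex (p, s) 0 = p"
  by (simp add: vertex_def)

lemma vertex_Cons_Suc: "vertex (p, c # s) (Suc m) = vertex (move p c, s) m"
  by (simp add: vertex_def)

lemma all_le_Suc_shift: "(\<forall>m\<le>Suc n. P m) \<longleftrightarrow> P 0 \<and> (\<forall>m\<le>n. P (Suc m))"
  using All_less_Suc2[of "Suc n" P] by (simp only: less_Suc_eq_le)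

text \<open>Joins the path conditions and the height bound for an arbitrary starting point, with a
  flag for the preceding step, so that the notion is stable under removal of the first step.\<close>

definition lattice_path_from :: "nat \<Rightarrow> bool \<Rightarrow> point \<Rightarrow> step list \<Rightarrow> bool" where
  "lattice_path_from k b p s \<longleftrightarrow>
     (\<forall>m\<le>length s. 0 \<le> fst (vertex (p, s) m) \<and> 0 \<le> snd (vertex (p, s) m)
        \<and> snd (vertex (p, s) m) < int k) \<and>
     snd (vertex (p, s) (length s)) = 0 \<and>
     (\<forall>m<length s. s ! m = East \<longrightarrow> snd (vertex (p, s) m) = 0) \<and>
     (\<forall>m<length s. s ! m = South \<longrightarrow> (if m = 0 then b else s ! (m - 1) = North_East)) \<and>
     (s = [] \<or> last s = South_East \<or> last s = South)"

lemma lattice_path_from_Nil: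
  "lattice_path_from k b (x, y) [] \<longleftrightarrow> 0 \<le> x \<and> y = 0 \<and> 0 < k"
  by (auto simp: lattice_path_from_def vertex_0)

lemma nth_pred_Cons: "(if m = 0 then c = d else s ! (m - 1) = d) \<longleftrightarrow> (c # s) ! m = d"
  by (cases m) auto

lemma lattice_path_from_Cons:
  "lattice_path_from k b p (c # s) \<longleftrightarrow>
     0 \<le> fst p \<and> 0 \<le> snd p \<and> snd p < int k \<and> (c = East \<longrightarrow> snd p = 0 \<and> s \<noteq> []) \<and> (c = South \<longrightarrow> b) \<and>
     (c = North_East \<longrightarrow> s \<noteq> []) \<and> lattice_path_from k (c = North_East) (move p c) s"
  unfolding lattice_path_from_def length_Cons all_le_Suc_shift All_less_Suc2 vertex_0 vertex_Cons_Suc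
    nth_Cons_0 nth_Cons_Suc diff_Suc_1 nth_pred_Cons
  by (cases c) (auto simp: last.simps)

lemma lattice_path_from_iff_admissible:
  "0 \<le> x \<Longrightarrow> lattice_path_from k b (x, int h) s \<longleftrightarrow> admissible k b h s"
proof (induction s arbitrary: b x h)
  case Nil
  then show ?case by (auto simp: lattice_path_from_Nil)
next
  case (Cons c s)
  \<comment> \<open>A descent from height 0 leads to height -1, which is not of the form
    \<open>int h\<close> and so lies outside the induction hypothesis.\<close>
  have neg: "\<not> lattice_path_from k b (x, -1) s" for b x
    by (cases s) (auto simp: lattice_path_from_Nil lattice_path_from_Cons)
  show ?case
  proof (cases c)
    case North_East
    \<comment> \<open>\<open>admissible\<close> has no clause against ending with North-East: such a
      word would stop at positive height.\<close>
    have "\<not> admissible k True (Suc h) []" by simp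
    then show ?thesis
      using Cons.IH[of "x + 1" True "Suc h"] Cons.prems North_East
      by (auto simp: lattice_path_from_Cons add.commute)
  next
    case South_East
    then show ?thesis
      using Cons.IH[of "x + 1" False "h - 1"] Cons.prems neg
      by (cases h) (auto simp: lattice_path_from_Cons)
  next
    case South
    then show ?thesis
      using Cons.IH[of "x" False "h - 1"] Cons.prems neg
      by (cases h) (auto simp: lattice_path_from_Cons)
  next
    case East
    then show ?thesis
      using Cons.IH[of "x + 1" False 0] Cons.prems
      by (auto simp: lattice_path_from_Cons)
  qed
qed

lemma lattice_path_special_iff_admissible:
  assumes "i \<le> k"
  shows "lattice_path P \<and> special_conditions k i P \<longleftrightarrow>
    fst P = (0, int (k - i)) \<and> admissible k False (k - i) (snd P)"
proof -
  obtain p s where P: "P = (p, s)" by (cases P)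
  have south: "(\<forall>m<length s. s ! m = South \<longrightarrow> 0 < m \<and> s ! (m - 1) = North_East) \<longleftrightarrow>
      (\<forall>m<length s. s ! m = South \<longrightarrow> (if m = 0 then False else s ! (m - 1) = North_East))"
    by (intro all_cong1 imp_cong refl) auto
  have start: "p = (0, int k - int i) \<longleftrightarrow> p = (0, int (k - i))" "p = (0, int (k - i)) \<Longrightarrow> fst p = 0"
    using assms by (auto simp: of_nat_diff)
  have "lattice_path P \<and> special_conditions k i P \<longleftrightarrow>
      p = (0, int (k - i)) \<and> lattice_path_from k False p s"
    unfolding P lattice_path_def special_conditions_def lattice_path_from_def Let_def fst_conv snd_conv
      south vertex_0 start(1)
    using start(2) by blast
  then show ?thesis
    by (auto simp: P lattice_path_from_iff_admissible)
qed

section \<open>Peaks and major index of a word\<close>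

definition peaks_from :: "bool \<Rightarrow> step list \<Rightarrow> nat set" where
  "peaks_from b s = {m. m < length s \<and> (if m = 0 then b else s ! (m - 1) = North_East) \<and>
     (s ! m = South \<or> s ! m = South_East)}"

lemma peaks_from_Cons:
  "peaks_from b (c # s) =
     (if b \<and> (c = South \<or> c = South_East) then {0} else {}) \<union> Suc ` peaks_from (c = North_East) s"
proof (rule set_eqI)
  fix m
  show "m \<in> peaks_from b (c # s) \<longleftrightarrow>
    m \<in> (if b \<and> (c = South \<or> c = South_East) then {0} else {}) \<union> Suc ` peaks_from (c = North_East) s"
    by (cases m) (auto simp: peaks_from_def nth_pred_Cons split: if_splits)
qed

lemma finite_peaks_from: "finite (peaks_from b s)"
  by (simp add: peaks_from_def)

lemma sum_peaks_from:
  "(\<Sum>m\<in>peaks_from b s. fst (vertex ((int x, y), s) m)) = int (maj b x s)"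
proof (induction s arbitrary: b x y)
  case (Cons c s)
  have "(\<Sum>m\<in>peaks_from b (c # s). fst (vertex ((int x, y), c # s) m))
    = (if b \<and> (c = South \<or> c = South_East) then int x else 0)
      + (\<Sum>m\<in>peaks_from (c = North_East) s. fst (vertex (move (int x, y) c, s) m))"
    unfolding peaks_from_Cons
    by (subst sum.union_disjoint)
       (auto simp: finite_peaks_from sum.reindex vertex_0 vertex_Cons_Suc)
  also have "\<dots> = int (maj b x (c # s))"
    using Cons.IH[where x = "Suc x"] Cons.IH[where x = x] by (cases c) (auto simp: add.commute)
  finally show ?case .
qed (simp add: peaks_from_def)

lemma major_index_eq: "major_index ((0, y), s) = int (maj False 0 s)"
proof -
  have "peaks ((0, y), s) = peaks_from False s"
    by (auto simp: peaks_def peaks_from_def split: if_splits)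
  then show ?thesis
    using sum_peaks_from[where b = False and x = 0 and y = y and s = s] by (simp add: major_index_def)
qed

lemma E_bar_eq:
  assumes "i \<le> k"
  shows "E_bar k i n j =
    card {s. admissible k False (k - i) s \<and> maj False 0 s = n \<and> count_list s South = j}"
proof -
  have "{P. lattice_path P \<and> special_conditions k i P \<and> major_index P = int n \<and> south_steps P = j}
    = Pair (0, int (k - i)) `
        {s. admissible k False (k - i) s \<and> maj False 0 s = n \<and> count_list s South = j}"
    using lattice_path_special_iff_admissible[OF assms]
    by (auto simp: major_index_eq south_steps_def image_iff)
       (metis major_index_eq of_nat_eq_iff prod.collapse)+
  then show ?thesis
    unfolding E_bar_def by (simp add: card_image inj_on_def)
qed

text \<open>Moving the start by \<open>d\<close> raises the abscissa of every peak by
  \<open>d\<close>. This is the source of the factors q^N in the recurrences.\<close>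

lemma maj_shift: "maj b (x + d) s = maj b x s + d * num_peaks b s"
  by (induction b x s rule: maj.induct) (auto simp: algebra_simps of_bool_def)

lemma maj_Suc_0: "maj b (Suc 0) s = maj b 0 s + num_peaks b s"
  using maj_shift[of b 0 1 s] by simp

text \<open>A set flag or a North-East step leaves a positive height, from which the next descent
  makes a peak. Without these no South step is possible, and a word after East would have to be
  empty, which is excluded.\<close>

lemma no_peaks:
  "admissible k b h s \<Longrightarrow> num_peaks b s = 0 \<Longrightarrow> (b \<longrightarrow> 0 < h) \<Longrightarrow> \<not> b \<and> s = replicate h South_East"
proof (induction k b h s rule: admissible.induct)
  case (2 k b h s) then show ?case by simp
next
  case (3 k b h s) then show ?case by (cases h) (auto split: if_splits)
next
  case (4 k b h s) then show ?case by (cases h) (auto split: if_splits)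
qed auto

lemma admissible_replicate: "h < k \<Longrightarrow> admissible k False h (replicate h South_East)"
  by (induction h) auto

lemma num_peaks_replicate: "num_peaks False (replicate h South_East) = 0"
  by (induction h) auto

lemma maj_replicate: "maj False x (replicate h South_East) = 0"
  by (induction h arbitrary: x) auto

lemma count_list_replicate_South_East: "count_list (replicate h South_East) South = 0"
  by (induction h) auto

text \<open>After the last peak a path only descends; before it, at most every other step is South,
  and each other step increases the abscissa.\<close>

lemma length_le_maj:
  "admissible k b h s \<Longrightarrow> (b \<longrightarrow> 0 < h) \<Longrightarrow> num_peaks b s > 0 \<Longrightarrow>
    2 * x + length s \<le> 2 * maj b x s + k + of_bool b"
proof (induction k b h s arbitrary: x rule: admissible.induct)
  case (2 k b h s)
  show ?case using "2.prems" "2.IH"[of "Suc x"] by (auto simp: of_bool_def)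
next
  case (3 k b h s)
  show ?case
  proof (cases "num_peaks False s = 0")
    case True
    then show ?thesis using 3 no_peaks[of k False "h - 1" s] by auto
  next
    case False
    then show ?thesis using "3.prems" "3.IH"[of "Suc x"] by auto
  qed
next
  case (4 k b h s)
  show ?case
  proof (cases "num_peaks False s = 0")
    case True
    then show ?thesis using 4 no_peaks[of k False "h - 1" s] by auto
  next
    case False
    then show ?thesis using "4.prems" "4.IH"[of x] by auto
  qed
next
  case (5 k b h s)
  show ?case using "5.prems" "5.IH"[of "Suc x"] by auto
qed auto

lemma UNIV_step: "UNIV = {North_East, South_East, South, East}"
  using step.exhaust by auto

instance step :: finite
  by standard (simp add: UNIV_step)

text \<open>Words without peaks are bare descents; \<open>length_le_maj\<close> bounds the others.
  Hence the sets counted in \<open>E_bar_eq\<close> are finite, and the weights are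
  summable.\<close>

lemma finite_admissible_maj_le:
  assumes "b \<longrightarrow> 0 < h"
  shows "finite {s. admissible k b h s \<and> maj b 0 s \<le> n}"
proof (rule finite_subset)
  show "{s. admissible k b h s \<and> maj b 0 s \<le> n} \<subseteq> {s. set s \<subseteq> UNIV \<and> length s \<le> 2 * n + k + h + 1}"
  proof
    fix s assume "s \<in> {s. admissible k b h s \<and> maj b 0 s \<le> n}"
    then have s: "admissible k b h s" "maj b 0 s \<le> n" by auto
    show "s \<in> {s. set s \<subseteq> UNIV \<and> length s \<le> 2 * n + k + h + 1}"
    proof (cases "num_peaks b s = 0")
      case True
      then show ?thesis using no_peaks[OF s(1) True assms] by auto
    next
      case False
      then show ?thesis using length_le_maj[OF s(1) assms, of 0] s(2) by (auto simp: of_bool_def split: if_splits)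
    qed
  qed
  show "finite {s :: step list. set s \<subseteq> UNIV \<and> length s \<le> 2 * n + k + h + 1}"
    by (rule finite_lists_length_le) simp
qed

section \<open>Generating functions of words and their recurrences\<close>

definition weight :: "bool \<Rightarrow> step list \<Rightarrow> series" where
  "weight b s = var_q ^ maj b 0 s * var_a ^ count_list s South"

lemma vanishes_below_var_a_power [simp]: "vanishes_below 0 (var_a ^ n)"
  by (induction n) (auto simp: var_a_def intro: vanishes_below_mult[where m = 0 and n = 0])

lemma vanishes_below_weight: "vanishes_below (int (maj b 0 s)) (weight b s)"
  unfolding weight_def by (rule vanishes_below_mult[where m = "int (maj b 0 s)" and n = 0]) auto

lemma weight_summable_on:
  assumes "b \<longrightarrow> 0 < h" and "A \<subseteq> {s. admissible k b h s}"
  shows "weight b summable_on A"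
proof (rule fls_summable_on)
  fix n
  have "{s \<in> A. \<not> vanishes_below n (weight b s)} \<subseteq> {s. admissible k b h s \<and> maj b 0 s \<le> nat n}"
  proof
    fix s assume s: "s \<in> {s \<in> A. \<not> vanishes_below n (weight b s)}"
    have "int (maj b 0 s) < n"
      using s vanishes_below_mono[OF vanishes_below_weight[of b s], of n] by (cases "int (maj b 0 s) < n") auto
    then show "s \<in> {s. admissible k b h s \<and> maj b 0 s \<le> nat n}"
      using s assms(2) by auto
  qed
  then show "finite {s \<in> A. \<not> vanishes_below n (weight b s)}"
    by (rule finite_subset) (rule finite_admissible_maj_le[OF assms(1)])
qed

definition path_set :: "nat \<Rightarrow> bool \<Rightarrow> nat \<Rightarrow> nat \<Rightarrow> step list set" where
  "path_set k b h N = {s. admissible k b h s \<and> num_peaks b s = N}"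

text \<open>With flag \<open>False\<close> this is F_h(N) of the overview, with flag
  \<open>True\<close> it is G_h(N).\<close>

definition path_gf :: "nat \<Rightarrow> bool \<Rightarrow> nat \<Rightarrow> nat \<Rightarrow> series" where
  "path_gf k b h N = infsum (weight b) (path_set k b h N)"

lemma path_gf_has_sum:
  "(b \<longrightarrow> 0 < h) \<Longrightarrow> (weight b has_sum path_gf k b h N) (path_set k b h N)"
  unfolding path_gf_def
  by (rule has_sum_infsum, rule weight_summable_on) (auto simp: path_set_def)

lemma admissible_less: "admissible k b h s \<Longrightarrow> h < k"
  by (induction k b h s rule: admissible.induct) auto

lemma path_gf_top: "path_gf k b k N = 0"
proof -
  have "path_set k b k N = {}"
    using admissible_less[of k b k] by (auto simp: path_set_def)
  then show ?thesis by (simp add: path_gf_def)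
qed

text \<open>Weights are taken from abscissa 0, so a peak at the start adds nothing. A step to the
  right shifts every later peak by one; a South step shifts none.\<close>

lemma weight_Cons:
  "weight b (North_East # s) = var_q ^ num_peaks True s * weight True s"
  "weight b (South_East # s) = var_q ^ num_peaks False s * weight False s"
  "weight b (South # s) = var_a * weight False s"
  "weight b (East # s) = var_q ^ num_peaks False s * weight False s"
  by (simp_all add: weight_def maj_Suc_0 power_add)

lemma has_sum_Cons:
  assumes "b' \<longrightarrow> 0 < h" and "\<And>s. s \<in> path_set k b' h N \<Longrightarrow> weight b (c # s) = x * weight b' s"
  shows "(weight b has_sum (x * path_gf k b' h N)) ((#) c ` path_set k b' h N)"
proof -
  have "((\<lambda>s. x * weight b' s) has_sum (x * path_gf k b' h N)) (path_set k b' h N)"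
    by (intro has_sum_cmult_right path_gf_has_sum assms(1))
  then have "((weight b \<circ> (#) c) has_sum (x * path_gf k b' h N)) (path_set k b' h N)"
    by (subst has_sum_cong[where g = "\<lambda>s. x * weight b' s"]) (use assms(2) in auto)
  then show ?thesis
    by (subst has_sum_reindex) auto
qed

lemma path_gf_False_no_peaks: "h < k \<Longrightarrow> path_gf k False h 0 = 1"
proof -
  assume "h < k"
  then have "path_set k False h 0 = {replicate h South_East}"
    unfolding path_set_def using no_peaks[of k False h] admissible_replicate[of h k] num_peaks_replicate[of h]
    by blast
  then show ?thesis
    by (simp add: path_gf_def weight_def maj_replicate count_list_replicate_South_East)
qed

lemma path_gf_True_no_peaks: "0 < h \<Longrightarrow> path_gf k True h 0 = 0"
proof -
  assume "0 < h"
  then have "path_set k True h 0 = {}"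
    using no_peaks[of k True h] by (auto simp: path_set_def)
  then show ?thesis by (simp add: path_gf_def)
qed

text \<open>East steps make the equation self-referential. With at least one peak the empty word is
  absent, and the remainder after East is automatically nonempty.\<close>

lemma path_gf_False_0:
  assumes "0 < k"
  shows "path_gf k False 0 (Suc N)
    = var_q ^ Suc N * path_gf k False 0 (Suc N) + var_q ^ Suc N * path_gf k True 1 (Suc N)"
proof -
  have "path_set k False 0 (Suc N)
    = (#) East ` path_set k False 0 (Suc N) \<union> (#) North_East ` path_set k True 1 (Suc N)"
    (is "?A = ?B")
  proof (rule set_eqI)
    fix s
    show "s \<in> ?A \<longleftrightarrow> s \<in> ?B"
      by (cases "(k, False, 0::nat, s)" rule: admissible.cases) (use assms in \<open>auto simp: path_set_def\<close>)
  qed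
  moreover have "(weight False has_sum (var_q ^ Suc N * path_gf k False 0 (Suc N)
      + var_q ^ Suc N * path_gf k True 1 (Suc N)))
    ((#) East ` path_set k False 0 (Suc N) \<union> (#) North_East ` path_set k True 1 (Suc N))"
    by (intro has_sum_Un_disjoint has_sum_Cons) (auto simp: path_set_def weight_Cons)
  ultimately show ?thesis
    by (metis has_sum_unique path_gf_has_sum)
qed

lemma path_gf_False_Suc:
  assumes "Suc h < k"
  shows "path_gf k False (Suc h) N
    = var_q ^ N * path_gf k False h N + var_q ^ N * path_gf k True (Suc (Suc h)) N"
proof -
  have "path_set k False (Suc h) N
    = (#) South_East ` path_set k False h N \<union> (#) North_East ` path_set k True (Suc (Suc h)) N"
    (is "?A = ?B")
  proof (rule set_eqI)
    fix s
    show "s \<in> ?A \<longleftrightarrow> s \<in> ?B"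
      by (cases "(k, False, Suc h, s)" rule: admissible.cases) (use assms in \<open>auto simp: path_set_def\<close>)
  qed
  moreover have "(weight False has_sum (var_q ^ N * path_gf k False h N
      + var_q ^ N * path_gf k True (Suc (Suc h)) N))
    ((#) South_East ` path_set k False h N \<union> (#) North_East ` path_set k True (Suc (Suc h)) N)"
    by (intro has_sum_Un_disjoint has_sum_Cons) (auto simp: path_set_def weight_Cons)
  ultimately show ?thesis
    by (metis has_sum_unique path_gf_has_sum)
qed

text \<open>Descending at once makes the start a peak and leaves \<open>N\<close>: South contributes
  \<open>var_a\<close>, South-East shifts the \<open>N\<close> remaining peaks.\<close>

lemma path_gf_True_Suc:
  assumes "Suc h < k"
  shows "path_gf k True (Suc h) (Suc N)
    = var_q ^ Suc N * path_gf k True (Suc (Suc h)) (Suc N) + (var_a + var_q ^ N) * path_gf k False h N"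
proof -
  have "path_set k True (Suc h) (Suc N)
    = (#) North_East ` path_set k True (Suc (Suc h)) (Suc N) \<union>
      ((#) South ` path_set k False h N \<union> (#) South_East ` path_set k False h N)"
    (is "?A = ?B")
  proof (rule set_eqI)
    fix s
    show "s \<in> ?A \<longleftrightarrow> s \<in> ?B"
      by (cases "(k, True, Suc h, s)" rule: admissible.cases) (use assms in \<open>auto simp: path_set_def\<close>)
  qed
  moreover have "(weight True has_sum (var_q ^ Suc N * path_gf k True (Suc (Suc h)) (Suc N)
      + (var_a * path_gf k False h N + var_q ^ N * path_gf k False h N)))
    ((#) North_East ` path_set k True (Suc (Suc h)) (Suc N) \<union>
      ((#) South ` path_set k False h N \<union> (#) South_East ` path_set k False h N))"
    by (intro has_sum_Un_disjoint has_sum_Cons) (auto simp: path_set_def weight_Cons)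
  ultimately have "path_gf k True (Suc h) (Suc N) = var_q ^ Suc N * path_gf k True (Suc (Suc h)) (Suc N)
      + (var_a * path_gf k False h N + var_q ^ N * path_gf k False h N)"
    by (metis has_sum_unique path_gf_has_sum zero_less_Suc)
  then show ?thesis by (simp add: algebra_simps)
qed

text \<open>One sum over all words is grouped in two ways, which identifies the given generating
  function with the sum over the number of peaks.\<close>

lemma E_gf_has_sum:
  assumes "i \<le> k"
  shows "(E_gf_term k i has_sum infsum (weight False) {s. admissible k False (k - i) s}) UNIV"
    and "(path_gf k False (k - i) has_sum infsum (weight False) {s. admissible k False (k - i) s}) UNIV"
proof -
  let ?A = "{s. admissible k False (k - i) s}"
  have *: "(weight False has_sum infsum (weight False) ?A) ?A"
    by (rule has_sum_infsum, rule weight_summable_on) auto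
  show "(E_gf_term k i has_sum infsum (weight False) ?A) UNIV"
  proof (rule has_sum_fibres[OF *, where key = "\<lambda>s. (maj False 0 s, count_list s South)"])
    fix y :: "nat \<times> nat"
    obtain n j where y: "y = (n, j)" by (cases y)
    let ?B = "{s \<in> ?A. (maj False 0 s, count_list s South) = y}"
    have "finite ?B"
      by (rule finite_subset[OF _ finite_admissible_maj_le[of False "k - i" k n]]) (auto simp: y)
    moreover have "E_gf_term k i y = sum (weight False) ?B"
    proof -
      have "sum (weight False) ?B = (\<Sum>s\<in>?B. var_q ^ n * var_a ^ j)"
        by (rule sum.cong) (auto simp: weight_def y)
      also have "\<dots> = of_nat (card ?B) * var_q ^ n * var_a ^ j"
        by (simp add: mult.assoc)
      also have "card ?B = E_bar k i n j"
        unfolding E_bar_eq[OF assms] by (rule arg_cong[where f = card]) (auto simp: y)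
      finally show ?thesis by (simp add: E_gf_term_def y)
    qed
    ultimately show "(weight False has_sum E_gf_term k i y) ?B"
      by (rule has_sum_finiteI)
  qed
  show "(path_gf k False (k - i) has_sum infsum (weight False) ?A) UNIV"
  proof (rule has_sum_fibres[OF *, where key = "num_peaks False"])
    fix N
    show "(weight False has_sum path_gf k False (k - i) N) {s \<in> ?A. num_peaks False s = N}"
      using path_gf_has_sum[of False "k - i" k N] by (simp add: path_set_def)
  qed
qed

subsection \<open>Solving the recurrences\<close>

definition tri :: "int \<Rightarrow> int" where
  "tri n = n * (n + 1) div 2"

lemma two_tri: "2 * tri n = n * (n + 1)"
  unfolding tri_def by simp

lemma tri_eqI: "2 * x = n * (n + 1) \<Longrightarrow> tri n = x"
  using two_tri[of n] by simp

lemma tri_0 [simp]: "tri 0 = 0"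
  by (simp add: tri_def)

lemma tri_uminus: "tri (- n) = tri n - n"
  by (rule tri_eqI) (use two_tri[of n] in \<open>simp add: algebra_simps\<close>)

lemma tri_reflect: "tri (- 1 - n) = tri n"
  by (rule tri_eqI) (use two_tri[of n] in \<open>simp add: algebra_simps\<close>)

lemma tri_Suc: "tri (n + 1) = tri n + n + 1"
  by (rule tri_eqI) (use two_tri[of n] in \<open>simp add: algebra_simps\<close>)

lemma tri_of_nat: "tri (int n) = int (Suc n choose 2)"
proof (induction n)
  case (Suc n)
  then show ?case
    using tri_Suc[of "int n"] by (simp add: numeral_2_eq_2 add.commute)
qed (simp add: numeral_2_eq_2)

text \<open>Stands for 1/(q)_r with the usual value 0 at negative \<open>r\<close>, which makes the
  finite sums below terminate by themselves and \<open>inv_qpoch_pred\<close> hold for every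
  integer.\<close>

definition inv_qpoch :: "int \<Rightarrow> series" where
  "inv_qpoch r = (if r < 0 then 0 else 1 / qpoch_fin var_q (nat r))"

lemma inv_qpoch_neg: "r < 0 \<Longrightarrow> inv_qpoch r = 0"
  by (simp add: inv_qpoch_def)

lemma inv_qpoch_of_nat: "inv_qpoch (int n) = 1 / qpoch_fin var_q n"
  by (simp add: inv_qpoch_def)

lemma vanishes_below_inv_qpoch: "vanishes_below 0 (inv_qpoch r)"
  by (auto simp: inv_qpoch_def intro!: vanishes_below_divide_qpoch_fin)

lemma inv_qpoch_pred: "(1 - var_q powi r) * inv_qpoch r = inv_qpoch (r - 1)"
proof -
  consider "r < 0" | "r = 0" | n where "r = int (Suc n)"
    by (metis gr0_implies_Suc linorder_neqE_linordered_idom zero_less_imp_eq_int)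
  then show ?thesis
  proof cases
    case 3
    have S: "qpoch_fin var_q (Suc n) = qpoch_fin var_q n * (1 - var_q ^ Suc n)"
      by (simp add: qpoch_fin_Suc)
    moreover have "qpoch_fin var_q (Suc n) \<noteq> 0"
      by (rule qpoch_fin_nonzero) simp
    ultimately have nz: "qpoch_fin var_q n \<noteq> 0" "1 - var_q ^ Suc n \<noteq> 0"
      by auto
    have p: "var_q powi r = var_q ^ Suc n"
      by (simp only: 3 power_int_of_nat)
    have inv: "inv_qpoch (r - 1) = 1 / qpoch_fin var_q n" "inv_qpoch r = 1 / qpoch_fin var_q (Suc n)"
      using inv_qpoch_of_nat[of n] inv_qpoch_of_nat[of "Suc n"] 3 by simp_all
    show ?thesis
      unfolding inv p S using nz by (simp add: divide_simps)
  qed (auto simp: inv_qpoch_neg)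
qed

text \<open>The exponent of \<open>q\<close> in the theta series, minus the triangular number that the summation of
  \<open>\<^sub>1\<phi>\<^sub>1\<close> contributes.\<close>

definition theta_exp :: "nat \<Rightarrow> int \<Rightarrow> int \<Rightarrow> int" where
  "theta_exp k h n = int k * n\<^sup>2 + (h + 1) * n - tri n"

text \<open>Twice the exponent is a quadratic in \<open>n\<close> whose sign is visible for
  \<open>n \<ge> 0\<close>; for negative \<open>n\<close> it is regrouped around
  \<open>n * (n + 1)\<close>.\<close>

lemma theta_exp_nonneg:
  assumes "0 \<le> h" and "h < int k"
  shows "0 \<le> theta_exp k h n"
proof -
  have eq: "2 * theta_exp k h n = (2 * int k - 1) * (n * n) + (2 * h + 1) * n"
    using two_tri[of n] by (simp add: theta_exp_def power2_eq_square algebra_simps)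
  have "0 \<le> (2 * int k - 1) * (n * n) + (2 * h + 1) * n"
  proof (cases "0 \<le> n")
    case True
    then show ?thesis using assms by simp
  next
    case False
    have "(2 * int k - 1) * (n * n) + (2 * h + 1) * n
      = (2 * int k - 1) * (n * (n + 1)) + (2 * int k - 2 * h - 2) * (- n)"
      by (simp add: algebra_simps)
    moreover have "0 \<le> (2 * int k - 1) * (n * (n + 1))"
      using False assms by (intro mult_nonneg_nonneg[OF _ mult_nonpos_nonpos]) auto
    moreover have "0 \<le> (2 * int k - 2 * h - 2) * (- n)"
      using False assms by (intro mult_nonneg_nonneg) auto
    ultimately show ?thesis by linarith
  qed
  then show ?thesis using eq by simp
qed

text \<open>\<open>L\<close> and \<open>R\<close> are independent because flagged words lead to
  \<open>(N - 1, N)\<close> and unflagged ones to \<open>(N, N)\<close>; \<open>c\<close> collects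
  the power of \<open>q\<close> free of \<open>n\<close>.\<close>

definition bailey_term :: "nat \<Rightarrow> int \<Rightarrow> int \<Rightarrow> int \<Rightarrow> int \<Rightarrow> int \<Rightarrow> series" where
  "bailey_term k h c L R n
     = (-1) powi n * var_q powi (c + theta_exp k h n) * inv_qpoch (L - n) * inv_qpoch (R + n)"

definition bailey_sum :: "nat \<Rightarrow> int \<Rightarrow> int \<Rightarrow> int \<Rightarrow> int \<Rightarrow> series" where
  "bailey_sum k h c L R = (\<Sum>n\<in>{-R..L}. bailey_term k h c L R n)"

lemma bailey_term_eq_0: "n \<notin> {-R..L} \<Longrightarrow> bailey_term k h c L R n = 0"
  by (auto simp: bailey_term_def inv_qpoch_neg)

lemma bailey_sum_superset:
  assumes "finite A" and "{-R..L} \<subseteq> A"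
  shows "bailey_sum k h c L R = (\<Sum>n\<in>A. bailey_term k h c L R n)"
  unfolding bailey_sum_def
  by (rule sum.mono_neutral_left) (use assms bailey_term_eq_0 in auto)

lemma bailey_sum_shift: "var_q powi d * bailey_sum k h c L R = bailey_sum k h (c + d) L R"
  by (simp add: bailey_sum_def bailey_term_def sum_distrib_left power_int_add mult_ac)

text \<open>Write 1 as q^(L-n) + (1 - q^(L-n)): the first part lowers \<open>h\<close> in the
  exponent, the second lowers \<open>L\<close> by \<open>inv_qpoch_pred\<close>.\<close>

lemma bailey_sum_left:
  "bailey_sum k h c L R = var_q powi L * bailey_sum k (h - 1) c L R + bailey_sum k h c (L - 1) R"
proof -
  have "bailey_term k h c L R n = var_q powi L * bailey_term k (h - 1) c L R n + bailey_term k h c (L - 1) R n"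
    for n
  proof -
    have e: "theta_exp k h n = theta_exp k (h - 1) n + n"
      by (simp add: theta_exp_def algebra_simps)
    have "var_q powi (c + theta_exp k h n) * var_q powi (L - n) = var_q powi L * var_q powi (c + theta_exp k (h - 1) n)"
      unfolding e by (simp add: add_ac flip: power_int_add)
    moreover have "inv_qpoch (L - 1 - n) = (1 - var_q powi (L - n)) * inv_qpoch (L - n)"
      using inv_qpoch_pred[of "L - n"] by (simp add: algebra_simps)
    ultimately show ?thesis
      unfolding bailey_term_def by algebra
  qed
  moreover have "bailey_sum k h c (L - 1) R = (\<Sum>n\<in>{-R..L}. bailey_term k h c (L - 1) R n)"
    by (rule bailey_sum_superset) auto
  ultimately show ?thesis
    by (simp add: bailey_sum_def sum_distrib_left sum.distrib)
qed

lemma bailey_sum_right: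
  "bailey_sum k h c L R = var_q powi R * bailey_sum k (h + 1) c L R + bailey_sum k h c L (R - 1)"
proof -
  have "bailey_term k h c L R n = var_q powi R * bailey_term k (h + 1) c L R n + bailey_term k h c L (R - 1) n"
    for n
  proof -
    have e: "theta_exp k (h + 1) n = theta_exp k h n + n"
      by (simp add: theta_exp_def algebra_simps)
    have "var_q powi (c + theta_exp k h n) * var_q powi (R + n) = var_q powi R * var_q powi (c + theta_exp k (h + 1) n)"
      unfolding e by (simp add: add_ac flip: power_int_add)
    moreover have "inv_qpoch (R - 1 + n) = (1 - var_q powi (R + n)) * inv_qpoch (R + n)"
      using inv_qpoch_pred[of "R + n"] by (simp add: algebra_simps)
    ultimately show ?thesis
      unfolding bailey_term_def by algebra
  qed
  moreover have "bailey_sum k h c L (R - 1) = (\<Sum>n\<in>{-R..L}. bailey_term k h c L (R - 1) n)"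
    by (rule bailey_sum_superset) auto
  ultimately show ?thesis
    by (simp add: bailey_sum_def sum_distrib_left sum.distrib)
qed

text \<open>The substitution of \<open>- n\<close> for \<open>n\<close> exchanges the two
  denominators. This is the boundary condition at height 0.\<close>

lemma bailey_sum_reflect_0: "bailey_sum k (-1) c N N = bailey_sum k 0 c N N"
  unfolding bailey_sum_def
proof (rule sum.reindex_bij_witness[where i = uminus and j = uminus])
  fix n
  have "theta_exp k 0 (- n) = theta_exp k (-1) n"
    by (simp add: theta_exp_def tri_uminus)
  then show "bailey_term k 0 c N N (- n) = bailey_term k (-1) c N N n"
    by (simp add: bailey_term_def power_int_minus mult_ac flip: power_int_inverse)
qed auto

text \<open>Replacing \<open>n\<close> by \<open>- 1 - n\<close> exchanges the denominators and
  fixes the exponent but flips the sign, so the sum is its own negative. This is the boundary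
  condition at height \<open>k\<close>.\<close>

lemma bailey_sum_top: "bailey_sum k (int k - 1) c (N - 1) N = 0"
proof -
  have "bailey_sum k (int k - 1) c (N - 1) N = - bailey_sum k (int k - 1) c (N - 1) N"
    unfolding bailey_sum_def sum_negf[symmetric]
  proof (rule sum.reindex_bij_witness[where i = "\<lambda>n. - 1 - n" and j = "\<lambda>n. - 1 - n"])
    fix n
    have "theta_exp k (int k - 1) (- 1 - n) = theta_exp k (int k - 1) n"
      by (simp add: theta_exp_def tri_reflect power2_eq_square algebra_simps)
    moreover have "(-1 :: series) powi (- 1 - n) = - ((-1) powi n)"
      by (cases "even n") (simp_all add: power_int_minus_left)
    moreover have eqs: "N - 1 - (- 1 - n) = N + n" "N + (- 1 - n) = N - 1 - n"
      by simp_all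
    ultimately show "- bailey_term k (int k - 1) c (N - 1) N (- 1 - n) = bailey_term k (int k - 1) c (N - 1) N n"
      unfolding bailey_term_def eqs by (simp add: mult_ac)
  qed auto
  then show ?thesis
    by (simp add: eq_neg_iff_add_eq_0 flip: mult_2)
qed

text \<open>This is a^N (-1/a)_N, written as a polynomial in a and q.\<close>

definition peak_weight :: "nat \<Rightarrow> series" where
  "peak_weight N = (\<Prod>j<N. var_a + var_q ^ j)"

lemma peak_weight_Suc: "peak_weight (Suc N) = peak_weight N * (var_a + var_q ^ N)"
  by (simp add: peak_weight_def)

text \<open>For each number of peaks the flagged functions come first, from the unflagged ones with
  one peak fewer; the unflagged functions then follow upwards from height 0.\<close>

lemma path_gf_closed_form:
  "(h < k \<longrightarrow> path_gf k False h N = peak_weight N * bailey_sum k (int h) (tri (int N)) (int N) (int N)) \<and>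
   (0 < h \<and> h \<le> k \<longrightarrow> path_gf k True h N
      = peak_weight N * bailey_sum k (int h - 1) (tri (int N) - int N) (int N - 1) (int N))"
proof (induction N arbitrary: h)
  case 0
  have "bailey_sum k (int h) 0 0 0 = 1"
    by (simp add: bailey_sum_def bailey_term_def theta_exp_def inv_qpoch_def)
  then show ?case
    by (auto simp: path_gf_False_no_peaks path_gf_True_no_peaks peak_weight_def bailey_sum_def)
next
  case (Suc N)
  define M where "M = int (Suc N)"
  have M: "int N = M - 1" and qM: "var_q ^ Suc N = var_q powi M" and triM: "tri (int N) = tri M - M"
    using tri_Suc[of "int N"] by (simp_all add: M_def add.commute flip: power_int_of_nat)
  have gf_True: "path_gf k True h (Suc N) = peak_weight (Suc N) * bailey_sum k (int h - 1) (tri M - M) (M - 1) M"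
    if "0 < h" "h \<le> k" for h
    using that(2,1)
  \<comment> \<open>Descending induction on the height, starting at \<open>k\<close>, where both
    sides are 0.\<close>
  proof (induction rule: inc_induct)
    case base
    then show ?case by (simp add: path_gf_top bailey_sum_top)
  next
    case (step h)
    then obtain h' where h': "h = Suc h'" by (cases h) auto
    have F: "path_gf k False h' N = peak_weight N * bailey_sum k (int h') (tri M - M) (M - 1) (M - 1)"
      using Suc.IH[of h'] step.hyps unfolding triM by (simp add: h' M)
    have "path_gf k True h (Suc N) = var_q powi M * path_gf k True (Suc h) (Suc N)
        + (var_a + var_q ^ N) * path_gf k False h' N"
      using path_gf_True_Suc[of h' k N, unfolded qM] step.hyps by (simp add: h')
    also have "\<dots> = peak_weight (Suc N) * (var_q powi M * bailey_sum k (int h) (tri M - M) (M - 1) M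
        + bailey_sum k (int h') (tri M - M) (M - 1) (M - 1))"
      using step.IH by (simp add: h' F peak_weight_Suc algebra_simps)
    also have "var_q powi M * bailey_sum k (int h) (tri M - M) (M - 1) M
        + bailey_sum k (int h') (tri M - M) (M - 1) (M - 1) = bailey_sum k (int h - 1) (tri M - M) (M - 1) M"
      using bailey_sum_right[of k "int h'" "tri M - M" "M - 1" M] by (simp add: h' add.commute)
    finally show ?case .
  qed
  have left: "bailey_sum k h (tri M) M M = var_q powi M * bailey_sum k (h - 1) (tri M) M M
      + var_q powi M * bailey_sum k h (tri M - M) (M - 1) M" for h
    using bailey_sum_left[of k h "tri M" M M] by (simp add: bailey_sum_shift)
  have gf_False: "path_gf k False h (Suc N) = peak_weight (Suc N) * bailey_sum k (int h) (tri M) M M"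
    if "h < k" for h
    using that
  proof (induction h)
    case 0
    \<comment> \<open>East steps put the unknown on both sides. The reflection at height 0 yields
      the same factor \<open>1 - var_q powi M\<close> for the closed form, and it cancels.\<close>
    have nz: "1 - var_q powi M \<noteq> 0"
      using qpoch_fin_nonzero[of var_q "Suc N"] by (auto simp: qpoch_fin_Suc simp flip: qM)
    have "(1 - var_q powi M) * path_gf k False 0 (Suc N) = var_q powi M * path_gf k True 1 (Suc N)"
      using path_gf_False_0[OF 0, of N] unfolding qM by (simp add: algebra_simps)
    also have "\<dots> = peak_weight (Suc N) * (var_q powi M * bailey_sum k 0 (tri M - M) (M - 1) M)"
      using gf_True[of 1] 0 by simp
    also have "var_q powi M * bailey_sum k 0 (tri M - M) (M - 1) M = (1 - var_q powi M) * bailey_sum k 0 (tri M) M M"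
      using left[of 0] by (simp add: bailey_sum_reflect_0 algebra_simps)
    finally show ?case using nz by simp
  next
    case (Suc h)
    have "path_gf k False (Suc h) (Suc N) = var_q powi M * path_gf k False h (Suc N)
        + var_q powi M * path_gf k True (Suc (Suc h)) (Suc N)"
      using path_gf_False_Suc[OF Suc.prems, of "Suc N"] unfolding qM .
    also have "\<dots> = peak_weight (Suc N) * bailey_sum k (int (Suc h)) (tri M) M M"
      using Suc gf_True[of "Suc (Suc h)"] left[of "int (Suc h)"] by (simp add: algebra_simps)
    finally show ?case .
  qed
  show ?case
    unfolding M_def[symmetric] using gf_True gf_False by blast
qed

text \<open>Row \<open>N\<close> sums to the generating function for \<open>N\<close> peaks; column
  \<open>n\<close> will give the \<open>n\<close>-th theta term up to a common factor.\<close>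

definition double_term :: "nat \<Rightarrow> int \<Rightarrow> nat \<times> int \<Rightarrow> series" where
  "double_term k h = (\<lambda>(N, n). peak_weight N * bailey_term k h (tri (int N)) (int N) (int N) n)"

lemma double_term_row_has_sum:
  assumes "h < k"
  shows "((\<lambda>n. double_term k (int h) (N, n)) has_sum path_gf k False h N) UNIV"
proof -
  have "((\<lambda>n. double_term k (int h) (N, n)) has_sum path_gf k False h N) {- int N..int N}"
    using path_gf_closed_form[of h k N] assms
    by (intro has_sum_finiteI) (simp_all add: double_term_def bailey_sum_def sum_distrib_left)
  then show ?thesis
    by (subst has_sum_cong_neutral[where T = "{- int N..int N}"])
       (auto simp: double_term_def bailey_term_eq_0)
qed

lemma vanishes_below_peak_weight: "vanishes_below 0 (peak_weight N)"
  unfolding peak_weight_def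
  by (rule vanishes_below_prod[where m = 0 and A = "{..<N}", simplified])
     (auto intro!: vanishes_below_add simp: var_a_def)

lemma power_int_minus_one_cases: "(-1 :: series) powi n \<in> {1, -1}"
  by (cases "even n") (auto simp: power_int_minus_left)

lemma vanishes_below_double_term:
  assumes "0 \<le> h" and "h < int k"
  shows "vanishes_below (int N) (double_term k h (N, n))"
proof -
  have "int N \<le> tri (int N)"
    unfolding tri_of_nat by (simp add: numeral_2_eq_2)
  then have "int N \<le> tri (int N) + theta_exp k h n"
    using theta_exp_nonneg[OF assms] by (simp add: add_increasing2)
  then have "vanishes_below (int N) (var_q powi (tri (int N) + theta_exp k h n))"
    by simp
  then have "vanishes_below (int N) ((-1) powi n * var_q powi (tri (int N) + theta_exp k h n))"
    using power_int_minus_one_cases[of n] by auto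
  then show ?thesis
    unfolding double_term_def bailey_term_def prod.case
    by (intro vanishes_below_mult[OF vanishes_below_peak_weight, where n = "int N"]
          vanishes_below_mult[OF _ vanishes_below_inv_qpoch, where m = "int N"]) auto
qed

text \<open>Orders grow with \<open>N\<close>, and for given \<open>N\<close> only the
  \<open>n\<close> of absolute value at most \<open>N\<close> occur. Unconditional summability
  justifies the exchange of rows and columns.\<close>

lemma double_term_summable_on:
  assumes "0 \<le> h" and "h < int k"
  shows "double_term k h summable_on UNIV"
proof (rule fls_summable_on)
  fix m
  have "{x \<in> UNIV. \<not> vanishes_below m (double_term k h x)} \<subseteq> {..nat m} \<times> {- m..m}"
  proof
    fix x assume "x \<in> {x \<in> UNIV. \<not> vanishes_below m (double_term k h x)}"
    then obtain N n where x: "x = (N, n)" and "\<not> vanishes_below m (double_term k h (N, n))"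
      by (cases x) auto
    then have "int N < m" "double_term k h (N, n) \<noteq> 0"
      using vanishes_below_mono[OF vanishes_below_double_term[OF assms, of N n], of m]
      by (cases "int N < m"; auto)+
    moreover from this(2) have "n \<in> {- int N..int N}"
      using bailey_term_eq_0 by (fastforce simp: double_term_def)
    ultimately show "x \<in> {..nat m} \<times> {- m..m}"
      by (auto simp: x)
  qed
  then show "finite {x \<in> UNIV. \<not> vanishes_below m (double_term k h x)}"
    by (rule finite_subset) auto
qed

subsection \<open>Summing over the number of peaks\<close>

lemma peak_weight_add: "peak_weight (r + m) = peak_weight r * (\<Prod>j<m. var_a + var_q ^ (r + j))"
  by (induction m) (simp_all add: peak_weight_Suc mult_ac) 

lemma Suc_add_choose_2: "Suc (r + m) choose 2 = (Suc r choose 2) + Suc r * m + (m choose 2)"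
  by (induction m) (simp_all add: numeral_2_eq_2)

text \<open>Terms with \<open>N < r\<close> vanish. Put \<open>N = r + m\<close>: the rest is a
  constant times \<open>phi_term\<close> for C = q^(2r+1) and z = -a q^(r+1), and (q)_(2r) completes
  the product at \<open>C\<close> to \<open>qpoch_inf var_q\<close>.\<close>

lemma phi_column_has_sum:
  "((\<lambda>N. peak_weight N * var_q powi tri (int N) * inv_qpoch (int N - int r) * inv_qpoch (int N + int r))
     has_sum peak_weight r * var_q powi tri (int r) * qpoch_inf (- var_a * var_q ^ Suc r) / qpoch_inf var_q)
     UNIV"
proof -
  define C z where "C = var_q * var_q ^ (2 * r)" and "z = - var_a * var_q ^ Suc r"
  have C: "vanishes_below 1 C"
    unfolding C_def by (rule vanishes_below_mult[where m = 1 and n = 0]) auto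
  have z: "vanishes_below 1 z"
    unfolding z_def by (rule vanishes_below_mult[where m = 0 and n = 1]) (auto simp: var_a_def simp del: power_Suc)
  let ?f = "\<lambda>N. peak_weight N * var_q powi tri (int N) * inv_qpoch (int N - int r) * inv_qpoch (int N + int r)"
  define c where "c = peak_weight r * var_q powi tri (int r) / qpoch_fin var_q (2 * r)"
  have "?f (r + m) = c * phi_term C z m" for m
  proof -
    have "(\<Prod>j<m. C * var_q ^ j - z) = (\<Prod>j<m. var_q ^ Suc r * (var_a + var_q ^ (r + j)))"
      by (rule prod.cong) (simp_all add: C_def z_def algebra_simps mult_2_right power_add)
    also have "\<dots> = var_q ^ (Suc r * m) * (\<Prod>j<m. var_a + var_q ^ (r + j))"
      by (simp only: prod.distrib prod_constant card_lessThan power_mult)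
    finally have P: "(\<Prod>j<m. C * var_q ^ j - z) = var_q ^ (Suc r * m) * (\<Prod>j<m. var_a + var_q ^ (r + j))" .
    have t: "var_q powi tri (int (r + m)) = var_q powi tri (int r) * var_q ^ (Suc r * m) * var_q ^ (m choose 2)"
      unfolding tri_of_nat Suc_add_choose_2 power_int_of_nat by (simp only: power_add)
    have i1: "inv_qpoch (int (r + m) - int r) = 1 / qpoch_fin var_q m"
      using inv_qpoch_of_nat[of m] by simp
    have "inv_qpoch (int (r + m) + int r) = 1 / qpoch_fin var_q (2 * r + m)"
      using inv_qpoch_of_nat[of "2 * r + m"] by (simp add: algebra_simps mult_2)
    also have "\<dots> = 1 / (qpoch_fin var_q (2 * r) * qpoch_fin C m)"
      unfolding qpoch_fin_add C_def ..
    finally have i2: "inv_qpoch (int (r + m) + int r) = 1 / (qpoch_fin var_q (2 * r) * qpoch_fin C m)" .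
    show ?thesis
      unfolding phi_term_def P t i1 i2 peak_weight_add c_def by (simp add: mult_ac)
  qed
  then have "((?f \<circ> (\<lambda>m. r + m)) has_sum (c * (qpoch_inf z / qpoch_inf C))) UNIV"
    using has_sum_cmult_right[OF phi_term_has_sum[OF C z], of c] by (simp add: o_def)
  then have "(?f has_sum (c * (qpoch_inf z / qpoch_inf C))) (range (\<lambda>m. r + m))"
    by (subst has_sum_reindex) auto
  also have "(?f has_sum (c * (qpoch_inf z / qpoch_inf C))) (range (\<lambda>m. r + m))
      \<longleftrightarrow> (?f has_sum (c * (qpoch_inf z / qpoch_inf C))) UNIV"
  proof (rule has_sum_cong_neutral)
    fix N assume "N \<in> UNIV - range (\<lambda>m. r + m)"
    then have "N < r"
      by (metis Diff_iff le_add_diff_inverse linorder_not_less rangeI)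
    then show "?f N = 0" by (simp add: inv_qpoch_neg)
  qed auto
  also have "qpoch_inf var_q = qpoch_fin var_q (2 * r) * qpoch_inf C"
    unfolding C_def by (rule qpoch_inf_split) (rule mult_X_power_neq_1, simp)
  then have "c * (qpoch_inf z / qpoch_inf C)
      = peak_weight r * var_q powi tri (int r) * qpoch_inf z / qpoch_inf var_q"
    by (simp add: c_def)
  finally show ?thesis unfolding z_def .
qed

section \<open>The part of the theta terms that involves a\<close>

lemma var_a_nonzero: "var_a \<noteq> 0"
  by (simp add: var_a_def Zero_fract_def eq_fract fls_const_nonzero)

text \<open>The coefficient of q^m on the left is the indeterminate, on the right a constant. Hence
  no shifted factorial in the theta terms has a zero factor.\<close>

lemma var_a_mult_X_power_int_neq_minus_1: "var_a * var_q powi m \<noteq> - 1"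
proof
  assume *: "var_a * var_q powi m = - 1"
  have "(var_a * var_q powi m) $$ m = Fract [:0, 1:] 1"
    by (simp add: var_a_def fls_X_power_int)
  with * have "Fract [:0, 1:] 1 = (- 1 :: series) $$ m"
    by simp
  then have "Fract [:0, 1:] 1 = (0 :: rat poly fract) \<or> Fract [:0, 1:] 1 = (- 1 :: rat poly fract)"
    by (auto split: if_splits)
  then show False
    by (auto simp: Zero_fract_def One_fract_def eq_fract one_pCons)
qed

lemma qpoch_inf_Suc:
  assumes "\<And>m. x * var_q powi m \<noteq> 1"
  shows "qpoch_inf x = (1 - x) * qpoch_inf (x * var_q)" and "qpoch_inf x \<noteq> 0"
proof -
  have *: "x * var_q ^ m \<noteq> 1" for m
    using assms[of "int m"] by (simp only: power_int_of_nat) simp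
  show "qpoch_inf x = (1 - x) * qpoch_inf (x * var_q)"
    using qpoch_inf_split[OF *, of 1] by (simp add: qpoch_fin_Suc)
  show "qpoch_inf x \<noteq> 0"
    by (rule qpoch_inf_nonzero[OF *])
qed

text \<open>Equals (-aq)_\<infinity> times a^n (-1/a)_n / (-aq)_n: the prefactor of the theorem
  cancels the denominator.\<close>

definition theta_factor :: "int \<Rightarrow> series" where
  "theta_factor n = var_a powi n * qpoch (- 1 / var_a) n * qpoch_inf (- var_a * var_q * var_q powi n)"

lemma minus_a_neq_1: "- var_a * var_q powi m * var_q powi n \<noteq> 1"
  using var_a_mult_X_power_int_neq_minus_1[of "m + n"]
  by (auto simp: power_int_add mult.assoc minus_equation_iff[of "_ * _"])

lemma minus_inverse_a_neq_1: "- 1 / var_a * var_q powi m * var_q powi n \<noteq> 1"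
proof
  assume "- 1 / var_a * var_q powi m * var_q powi n = 1"
  then have "- (var_q powi (m + n)) = var_a"
    using var_a_nonzero by (simp add: power_int_add field_simps)
  then have "var_a * var_q powi (- (m + n)) = - (var_q powi (m + n) * var_q powi (- (m + n)))"
    by (metis mult_minus_left)
  also have "\<dots> = - 1"
    using power_int_add[of var_q "m + n" "- (m + n)"] by simp
  finally have "var_a * var_q powi (- (m + n)) = - 1" .
  then show False
    using var_a_mult_X_power_int_neq_minus_1 by blast
qed

text \<open>One step in \<open>n\<close> changes one factor of each infinite product. As
  \<open>n\<close> is any integer, this single relation determines the values on both sides of
  0.\<close>

lemma theta_factor_Suc:
  "theta_factor (n + 1) * (1 + var_a * var_q powi (n + 1)) = theta_factor n * (var_a + var_q powi n)"
proof -
  let ?x = "- 1 / var_a" and ?y = "- var_a"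
  have X: "qpoch_inf (?x * var_q powi n) = (1 - ?x * var_q powi n) * qpoch_inf (?x * var_q powi (n + 1))"
    using qpoch_inf_Suc(1)[OF minus_inverse_a_neq_1, of n] by (simp add: power_int_add mult.assoc)
  have nz: "qpoch_inf (?x * var_q powi n) \<noteq> 0"
    by (rule qpoch_inf_Suc(2)[OF minus_inverse_a_neq_1])
  have Y: "qpoch_inf (?y * var_q powi (n + 1))
      = (1 - ?y * var_q powi (n + 1)) * qpoch_inf (?y * var_q * var_q powi (n + 1))"
    using qpoch_inf_Suc(1)[OF minus_a_neq_1, of "n + 1"] by (simp add: mult_ac)
  define u v w where "u = qpoch_inf (?x * var_q powi (n + 1))" and "v = 1 - ?x * var_q powi n"
    and "w = qpoch_inf (?y * var_q * var_q powi (n + 1))"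
  have uv: "u \<noteq> 0" "v \<noteq> 0" using X nz by (auto simp: u_def v_def)
  have av: "var_a * v = var_a + var_q powi n"
    using var_a_nonzero by (simp add: v_def field_simps)
  have T1: "theta_factor (n + 1) = var_a powi n * var_a * (qpoch_inf ?x / u) * w"
    using var_a_nonzero by (simp add: theta_factor_def qpoch_def power_int_add u_def w_def)
  have T2: "theta_factor n = var_a powi n * (qpoch_inf ?x / (v * u)) * ((1 - ?y * var_q powi (n + 1)) * w)"
  proof -
    have "?y * var_q * var_q powi n = ?y * var_q powi (n + 1)"
      by (simp add: power_int_add mult_ac)
    then show ?thesis
      by (simp only: theta_factor_def qpoch_def X Y u_def v_def w_def)
  qed
  show ?thesis
    unfolding T1 T2 av[symmetric] using uv by (simp add: field_simps)
qed

lemma one_plus_a_X_power_int_nonzero: "1 + var_a * var_q powi n \<noteq> 0"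
  using var_a_mult_X_power_int_neq_minus_1[of n] by (metis add.commute eq_neg_iff_add_eq_0)

lemma theta_factor_of_nat:
  "theta_factor (int r) = peak_weight r * qpoch_inf (- var_a * var_q ^ Suc r)"
proof (induction r)
  case 0
  have "qpoch_inf (- 1 / var_a) \<noteq> 0"
    using qpoch_inf_Suc(2)[OF minus_inverse_a_neq_1, of 0] by simp
  then show ?case by (simp add: theta_factor_def qpoch_def peak_weight_def)
next
  case (Suc r)
  have p: "var_q powi (int r + 1) = var_q ^ Suc r"
    by (metis add.commute of_nat_Suc power_int_of_nat)
  have "qpoch_inf (- var_a * var_q ^ Suc r)
      = (1 - - var_a * var_q ^ Suc r) * qpoch_inf (- var_a * var_q ^ Suc r * var_q)"
    by (rule qpoch_inf_Suc(1)) (rule minus_a_neq_1[of "int (Suc r)", unfolded power_int_of_nat])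
  then have "qpoch_inf (- var_a * var_q ^ Suc r)
      = (1 + var_a * var_q powi (int r + 1)) * qpoch_inf (- var_a * var_q ^ Suc (Suc r))"
    unfolding p by (simp add: mult_ac)
  then have "theta_factor (int r + 1) * (1 + var_a * var_q powi (int r + 1))
    = peak_weight (Suc r) * qpoch_inf (- var_a * var_q ^ Suc (Suc r)) * (1 + var_a * var_q powi (int r + 1))"
    unfolding theta_factor_Suc Suc peak_weight_Suc by (simp add: mult_ac)
  then show ?case
    using one_plus_a_X_power_int_nonzero[of "int r + 1"] by (simp add: add.commute)
qed

text \<open>\<open>theta_factor_Suc\<close> is used at \<open>- r - 1\<close> and at
  \<open>r\<close>; its factors there agree up to powers of \<open>q\<close>.\<close>

lemma theta_factor_uminus: "theta_factor (- int r) = var_q ^ r * theta_factor (int r)"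
proof (induction r)
  case (Suc r)
  let ?s = "int r"
  have neg: "theta_factor (- ?s) * (1 + var_a * var_q powi (- ?s))
      = theta_factor (- ?s - 1) * (var_a + var_q powi (- ?s - 1))"
    using theta_factor_Suc[of "- ?s - 1"] by simp
  have 1: "var_q ^ r * (1 + var_a * var_q powi (- ?s)) = var_a + var_q powi ?s"
    using power_int_add[of var_q ?s "- ?s"] by (simp add: algebra_simps)
  have 2: "var_q powi (?s + 1) * (var_a + var_q powi (- ?s - 1)) = 1 + var_a * var_q powi (?s + 1)"
    using power_int_add[of var_q "?s + 1" "- ?s - 1"] by (simp add: algebra_simps)
  have "theta_factor (- ?s - 1) * (1 + var_a * var_q powi (?s + 1))
    = var_q powi (?s + 1) * (theta_factor (- ?s) * (1 + var_a * var_q powi (- ?s)))"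
    unfolding 2[symmetric] neg by (simp only: mult_ac)
  also have "\<dots> = var_q powi (?s + 1) * (theta_factor ?s * (var_a + var_q powi ?s))"
    unfolding Suc 1[symmetric] by (simp only: mult_ac)
  also have "\<dots> = (var_q powi (?s + 1) * theta_factor (?s + 1)) * (1 + var_a * var_q powi (?s + 1))"
    unfolding theta_factor_Suc[symmetric] by (simp only: mult_ac)
  finally have "theta_factor (- ?s - 1) = var_q powi (?s + 1) * theta_factor (?s + 1)"
    using one_plus_a_X_power_int_nonzero[of "?s + 1"] by simp
  moreover have "- int (Suc r) = - ?s - 1" "int (Suc r) = ?s + 1"
    by simp_all
  ultimately show ?case
    by (metis power_int_of_nat)
qed simp

text \<open>The power of \<open>q\<close> in \<open>theta_factor_uminus\<close> is the difference
  between \<open>tri n\<close> and \<open>tri (- n)\<close>, so the product depends only on the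
  absolute value of \<open>n\<close>, as the column sums do.\<close>

lemma theta_factor_eq:
  "theta_factor n * var_q powi tri n
    = peak_weight (nat \<bar>n\<bar>) * var_q powi tri \<bar>n\<bar> * qpoch_inf (- var_a * var_q ^ Suc (nat \<bar>n\<bar>))"
proof (cases "0 \<le> n")
  case True
  then show ?thesis
    using theta_factor_of_nat[of "nat n"] by (simp add: mult_ac)
next
  case False
  define r where "r = nat (- n)"
  have n: "n = - int r" using False by (simp add: r_def)
  have "var_q ^ r * var_q powi tri (- int r) = var_q powi tri (int r)"
    using power_int_add[of var_q "int r" "tri (- int r)"] by (simp add: tri_uminus)
  then show ?thesis
    unfolding n theta_factor_uminus by (simp add: theta_factor_of_nat mult_ac)
qed

lemma double_term_column_has_sum:
  assumes "i \<le> k"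
  shows "((\<lambda>N. double_term k (int (k - i)) (N, n)) has_sum
     qpoch_inf (- var_a * var_q) / qpoch_inf var_q * theta_term k i n) UNIV"
proof -
  define r where "r = nat \<bar>n\<bar>"
  define s where "s = (- 1) powi n * var_q powi theta_exp k (int (k - i)) n"
  have prod: "inv_qpoch (int N - int r) * inv_qpoch (int N + int r) = inv_qpoch (int N - n) * inv_qpoch (int N + n)" for N
    by (cases "0 \<le> n") (simp_all add: r_def mult.commute)
  have "double_term k (int (k - i)) (N, n)
    = s * (peak_weight N * var_q powi tri (int N) * inv_qpoch (int N - int r) * inv_qpoch (int N + int r))" for N
    using prod[of N] by (simp add: double_term_def bailey_term_def s_def power_int_add mult.assoc)
  then have sum: "((\<lambda>N. double_term k (int (k - i)) (N, n)) has_sum s * (peak_weight r * var_q powi tri (int r)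
       * qpoch_inf (- var_a * var_q ^ Suc r) / qpoch_inf var_q)) UNIV"
    using has_sum_cmult_right[OF phi_column_has_sum[of r], of s] by simp
  have t: "peak_weight r * var_q powi tri (int r) * qpoch_inf (- var_a * var_q ^ Suc r)
      = theta_factor n * var_q powi tri n"
    using theta_factor_eq[of n] by (simp add: r_def)
  \<comment> \<open>The triangular number removed in \<open>theta_exp\<close> returns here from the
    column sum.\<close>
  have e: "var_q powi theta_exp k (int (k - i)) n * var_q powi tri n
      = var_q powi (int k * n\<^sup>2 + (int k - int i + 1) * n)"
    using assms by (simp add: theta_exp_def of_nat_diff flip: power_int_add)
  have nz: "qpoch_inf (- var_a * var_q) \<noteq> 0"
    using qpoch_inf_Suc(2)[OF minus_a_neq_1, of 1] by simp
  have "s * (theta_factor n * var_q powi tri n / qpoch_inf var_q)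
    = (- 1) powi n * (var_q powi theta_exp k (int (k - i)) n * var_q powi tri n) * theta_factor n / qpoch_inf var_q"
    by (simp add: s_def)
  also have "\<dots> = qpoch_inf (- var_a * var_q) / qpoch_inf var_q * theta_term k i n"
    unfolding e theta_term_def theta_factor_def qpoch_def[of "- var_a * var_q"] using nz by simp
  finally have eq: "s * (theta_factor n * var_q powi tri n / qpoch_inf var_q)
    = qpoch_inf (- var_a * var_q) / qpoch_inf var_q * theta_term k i n" .
  show ?thesis using sum unfolding t eq .
qed

theorem theorem1p5:
  fixes k i :: nat
  assumes "1 \<le> k" and "1 \<le> i" and "i \<le> k"
  shows "E_gf_term k i summable_on UNIV
    \<and> theta_term k i summable_on UNIV
    \<and> E_gf k i =
        qpoch_inf (- var_a * var_q) / qpoch_inf var_q * (\<Sum>\<^sub>\<infinity>n\<in>UNIV. theta_term k i n)"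
proof -
  let ?h = "k - i" and ?K = "qpoch_inf (- var_a * var_q) / qpoch_inf var_q"
  have h: "?h < k" "0 \<le> int ?h" "int ?h < int k"
    using assms by auto
  define E where "E = infsum (weight False) {s. admissible k False ?h s}"
  have E: "(E_gf_term k i has_sum E) UNIV" "(path_gf k False ?h has_sum E) UNIV"
    unfolding E_def using E_gf_has_sum[OF assms(3)] by blast+
  obtain D where D: "(double_term k (int ?h) has_sum D) (UNIV \<times> UNIV)"
    using double_term_summable_on[OF h(2,3)] by (auto simp: summable_on_def)
  \<comment> \<open>Summation by rows, that is, by the number of peaks.\<close>
  have "(path_gf k False ?h has_sum D) UNIV"
    by (rule has_sum_SigmaD[OF D double_term_row_has_sum[OF h(1)]])
  with E(2) have "D = E" by (rule has_sum_unique[rotated])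
  \<comment> \<open>Summation by columns after exchanging the two indices.\<close>
  have "((\<lambda>(n, N). double_term k (int ?h) (N, n)) has_sum D) (UNIV \<times> UNIV)"
    using D has_sum_reindex_bij_betw[of prod.swap UNIV UNIV "double_term k (int ?h)" D]
    by (simp add: case_prod_unfold prod.swap_def bij_swap)
  then have "((\<lambda>n. ?K * theta_term k i n) has_sum E) UNIV"
    unfolding \<open>D = E\<close> by (rule has_sum_SigmaD) (simp only: prod.case double_term_column_has_sum[OF assms(3)])
  \<comment> \<open>Dividing by the nonzero prefactor gives summability of the theta series together
    with its value.\<close>
  then have "((\<lambda>n. inverse ?K * (?K * theta_term k i n)) has_sum (inverse ?K * E)) UNIV"
    by (rule has_sum_cmult_right)
  moreover have K: "?K \<noteq> 0"
    using qpoch_inf_Suc(2)[OF minus_a_neq_1, of 1] qpoch_inf_nonzero_of_vanishing[of var_q] by simp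
  ultimately have \<theta>: "(theta_term k i has_sum (inverse ?K * E)) UNIV"
    by (simp add: mult.assoc[symmetric])
  have "E_gf k i = ?K * (\<Sum>\<^sub>\<infinity>n\<in>UNIV. theta_term k i n)"
    unfolding E_gf_def infsumI[OF E(1)] infsumI[OF \<theta>] using K by (simp add: mult.assoc[symmetric])
  with E(1) \<theta> show ?thesis
    by (blast intro: has_sum_imp_summable)
qed

end
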